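(* Let $n=1$. Consider the chain complexes $(\{C_{m,w,-w}\}_{m\ge1},\partial)$ of double weight $(w,-w)$ of the Lie superalgebra $\mathfrak g$ of polynomial vector fields and polynomial differential forms on $\mathbb R$, and their Betti numbers $b_m=\dim\bigl(\ker(\partial|_{C_{m,w,-w}})/\partial(C_{m+1,w,-w})\bigr)$, where $\partial=0$ on $C_{1,w,-w}$. Then: (i) for $w=0$: $(b_1,b_2,b_3)=(0,0,1)$; (ii) for $w=1$: $(b_1,b_2,b_3,b_4)=(0,0,1,1)$; (iii) for $w=2$: $(b_2,b_3,b_4,b_5)=(1,0,0,1)$.
   Context: Lie superalgebra: On the line $\mathbb R$ with coordinate $x$, for integers $j\ge 0$ put $\mathfrak g(0)_j=\mathbb R\,x^j\frac{d}{dx}$ (vector fields), $\mathfrak g(1)_j=\mathbb R\,x^j$ (functions, i.e. 0-forms), $\mathfrak g(2)_j=\mathbb R\,x^j\,dx$ (1-forms), and $\mathfrak g=\bigoplus_{i\in\{0,1,2\},\,j\ge 0}\mathfrak g(i)_j$. An element of $\mathfrak g(i)_j$ has degree $i$ and parity $i \bmod 2$. The super bracket is: $[X,Y]$ the usual Lie bracket of vector fields; $[X,\alpha]=L_X\alpha=-[\alpha,X]$ (Lie derivative) for a vector field $X$ and a form $\alpha$; and $[\alpha,\beta]=(-1)^a d(\alpha\wedge\beta)$ for an $a$-form $\alpha$ and a form $\beta$ (so $[f,g]=d(fg)$ for functions, and the bracket of a 1-form with any form is $0$). Chains: The $m$-th chain space ($m\ge1$) is the space spanned by the products $A_1\bigtriangleup\cdots\bigtriangleup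 A_m$ of elements of $\mathfrak g$, where $\bigtriangleup$ is the associative multilinear product subject to $A\bigtriangleup A'+(-1)^{ii'}A'\bigtriangleup A=0$ for $A$ of degree $i$ and $A'$ of degree $i'$ (skew-symmetric unless both factors are functions, symmetric between functions). The boundary operator is $$\partial(A_1\bigtriangleup\cdots\bigtriangleup A_m)=\sum_{i<j}(-1)^{\,i-1+a_i\sum_{i<s<j}a_s}\,A_1\bigtriangleup\cdots\widehat{A_i}\cdots\bigtriangleup[A_i,A_j]\bigtriangleup\cdots\bigtriangleup A_m ,$$ where $a_s$ is the degree of $A_s$ and $[A_i,A_j]$ stands in the place of $A_j$; $\partial\circ\partial=0$. Weights: For $A_s\in\mathfrak g(i_s)_{j_s}$ the product $A_1\bigtriangleup\cdots\bigtriangleup A_m$ has primary weight $\sum_{s=1}^m i_s$ and secondary weight $-m+\sum_{s=1}^m j_s$. $C_{m,w,h}$ denotes the span of all such products of length $m$ with primary weight $w$ and secondary weight $h$; $\partial$ maps $C_{m,w,h}$ to $C_{m-1,w,h}$. The chain spaces $C_{m,w,-w}$ ($m\ge1$) not covered by the listed Betti numbers are zero. *)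

theory Defs
  imports Complex_Main "HOL-Library.Poly_Mapping" "HOL-Library.FuncSet"
    "HOL-Computational_Algebra.Polynomial" "HOL-Combinatorics.Transposition"
begin

section \<open>The Lie superalgebra\<close>

text \<open>The superalgebra is the direct sum of three copies of the polynomial ring. Its homogeneous
  elements are the vector fields \<open>p d/dx\<close>, the functions \<open>f\<close> and the 1-forms \<open>q dx\<close>; each of the
  three zero elements keeps its degree. Products of homogeneous elements span the chain
  spaces, so inhomogeneous elements are not needed.\<close>

datatype elem = Vect "real poly" | Fn "real poly" | Form "real poly"

primrec deg :: "elem \<Rightarrow> nat" where
  "deg (Vect p) = 0"
| "deg (Fn f) = 1"
| "deg (Form q) = 2"

text \<open>Degree \<open>i\<close> part, with \<open>p\<close> the coefficient of \<open>d/dx\<close>, \<open>1\<close> or \<open>dx\<close> respectively.\<close>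

definition part :: "nat \<Rightarrow> real poly \<Rightarrow> elem" where
  "part i = (if i = 0 then Vect else if i = 1 then Fn else Form)"

text \<open>For \<open>X = p d/dx\<close>: \<open>L_X f = p f'\<close> and, by Cartan's formula, \<open>L_X (q dx) = d (p q)\<close>.
  A form of degree at least 2 on the line vanishes; as an element it is the zero 1-form.\<close>

fun bracket :: "elem \<Rightarrow> elem \<Rightarrow> elem" where
  "bracket (Vect p) (Vect q) = Vect (p * pderiv q - q * pderiv p)"
| "bracket (Vect p) (Fn f) = Fn (p * pderiv f)"
| "bracket (Vect p) (Form q) = Form (pderiv (p * q))"
| "bracket (Fn f) (Vect p) = Fn (- (p * pderiv f))"
| "bracket (Form q) (Vect p) = Form (- pderiv (p * q))"
| "bracket (Fn f) (Fn g) = Form (pderiv (f * g))"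
| "bracket (Fn f) (Form q) = Form 0"
| "bracket (Form q) (Fn f) = Form 0"
| "bracket (Form q) (Form r) = Form 0"

text \<open>The summand of degree \<open>i\<close> spanned by the monomial \<open>x^j\<close>.\<close>

definition component :: "nat \<Rightarrow> nat \<Rightarrow> elem set" where
  "component i j = {part i (monom c j) | c. True}"


section \<open>Chains\<close>

instantiation poly_mapping :: (type, real_vector) real_vector
begin

lift_definition scaleR_poly_mapping :: "real \<Rightarrow> ('a \<Rightarrow>\<^sub>0 'b) \<Rightarrow> 'a \<Rightarrow>\<^sub>0 'b"
  is "\<lambda>c f x. c *\<^sub>R f x"
  by (erule finite_subset[rotated]) auto

instance
  by standard (transfer; auto simp: fun_eq_iff scaleR_add_left scaleR_add_right)+

end

text \<open>The chains are the free vector space on words of homogeneous elements, modulo linearity in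
  each factor and the supercommutation rule.\<close>

inductive_set chain_relations :: "(elem list \<Rightarrow>\<^sub>0 real) set" where
  multilinear: "i \<le> 2 \<Longrightarrow>
    Poly_Mapping.single (us @ part i (smult a p + smult b q) # vs) 1
    - a *\<^sub>R Poly_Mapping.single (us @ part i p # vs) 1
    - b *\<^sub>R Poly_Mapping.single (us @ part i q # vs) 1 \<in> chain_relations"
| supercommute:
    "Poly_Mapping.single (us @ A # B # vs) 1
    + (-1) ^ (deg A * deg B) *\<^sub>R Poly_Mapping.single (us @ B # A # vs) 1 \<in> chain_relations"

quotient_type chain = "elem list \<Rightarrow>\<^sub>0 real" / "\<lambda>x y. x - y \<in> span chain_relations"
proof (rule equivpI)
  show "reflp (\<lambda>x y. x - y \<in> span chain_relations)"
    by (rule reflpI) (simp add: span_zero)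
  show "symp (\<lambda>x y. x - y \<in> span chain_relations)"
    by (rule sympI) (use span_neg in fastforce)
  show "transp (\<lambda>x y. x - y \<in> span chain_relations)"
    by (rule transpI) (use span_add in fastforce)
qed

instantiation chain :: real_vector
begin

lift_definition zero_chain :: chain is 0 .

lift_definition plus_chain :: "chain \<Rightarrow> chain \<Rightarrow> chain" is "(+)"
  by (simp add: add_diff_add span_add)

lift_definition minus_chain :: "chain \<Rightarrow> chain \<Rightarrow> chain" is "(-)"
proof -
  fix a b c d :: "elem list \<Rightarrow>\<^sub>0 real"
  assume "a - b \<in> span chain_relations" "c - d \<in> span chain_relations"
  then have "(a - b) - (c - d) \<in> span chain_relations" by (rule span_diff)
  then show "a - c - (b - d) \<in> span chain_relations" by (simp add: algebra_simps)
qed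

lift_definition uminus_chain :: "chain \<Rightarrow> chain" is uminus
  by (use span_neg in fastforce)

lift_definition scaleR_chain :: "real \<Rightarrow> chain \<Rightarrow> chain" is "scaleR"
  by (simp flip: scaleR_diff_right add: span_scale)

instance
  by standard (transfer; simp add: span_zero algebra_simps)+

end

text \<open>\<open>tri [A1, \<dots>, Am]\<close> is the product of \<open>A1, \<dots>, Am\<close>.\<close>

definition tri :: "elem list \<Rightarrow> chain" where
  "tri As = abs_chain (Poly_Mapping.single As 1)"

lemma tri_multilinear:
  assumes "i \<le> 2"
  shows "tri (us @ part i (smult a p + smult b q) # vs) =
    a *\<^sub>R tri (us @ part i p # vs) + b *\<^sub>R tri (us @ part i q # vs)"
  unfolding tri_def scaleR_chain.abs_eq plus_chain.abs_eq chain.abs_eq_iff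
  using span_base[OF chain_relations.multilinear[OF assms]] by (simp only: diff_diff_eq)

lemma tri_supercommute:
  "tri (us @ A # B # vs) = - ((-1) ^ (deg A * deg B) *\<^sub>R tri (us @ B # A # vs))"
  unfolding tri_def scaleR_chain.abs_eq uminus_chain.abs_eq chain.abs_eq_iff
  using span_base[OF chain_relations.supercommute] by (simp only: diff_minus_eq_add)


section \<open>The boundary operator\<close>

text \<open>Positions are counted from 0 here, so the sign exponent starts with \<open>i\<close> instead of \<open>i - 1\<close>.\<close>

definition boundary_term :: "elem list \<Rightarrow> nat \<Rightarrow> nat \<Rightarrow> chain" where
  "boundary_term As i j =
    (-1) ^ (i + deg (As ! i) * (\<Sum>s\<in>{i<..<j}. deg (As ! s))) *\<^sub>R
    tri (take i As @ drop (Suc i) (As[j := bracket (As ! i) (As ! j)]))"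

definition boundary_word :: "elem list \<Rightarrow> chain" where
  "boundary_word As = (\<Sum>(i, j) \<in> {(i, j). i < j \<and> j < length As}. boundary_term As i j)"

definition boundary_free :: "(elem list \<Rightarrow>\<^sub>0 real) \<Rightarrow> chain" where
  "boundary_free x = (\<Sum>As \<in> Poly_Mapping.keys x. Poly_Mapping.lookup x As *\<^sub>R boundary_word As)"

lemma boundary_free_superset:
  assumes "finite S" "Poly_Mapping.keys x \<subseteq> S"
  shows "boundary_free x = (\<Sum>As \<in> S. Poly_Mapping.lookup x As *\<^sub>R boundary_word As)"
  unfolding boundary_free_def
  by (rule sum.mono_neutral_left) (use assms in \<open>auto simp: in_keys_iff\<close>)

lemma boundary_free_single [simp]: "boundary_free (Poly_Mapping.single As 1) = boundary_word As"
  by (simp add: boundary_free_def)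

lemma linear_boundary_free: "linear boundary_free"
proof (rule linearI)
  fix x y :: "elem list \<Rightarrow>\<^sub>0 real" and c :: real
  let ?S = "Poly_Mapping.keys x \<union> Poly_Mapping.keys y"
  have "boundary_free (x + y) =
      (\<Sum>As\<in>?S. Poly_Mapping.lookup (x + y) As *\<^sub>R boundary_word As)"
    by (rule boundary_free_superset) (use Poly_Mapping.keys_add[of x y] in auto)
  also have "\<dots> = boundary_free x + boundary_free y"
    by (simp add: boundary_free_superset[of ?S x] boundary_free_superset[of ?S y]
        lookup_add scaleR_add_left sum.distrib)
  finally show "boundary_free (x + y) = boundary_free x + boundary_free y" .
  have "boundary_free (c *\<^sub>R x) =
      (\<Sum>As\<in>Poly_Mapping.keys x. Poly_Mapping.lookup (c *\<^sub>R x) As *\<^sub>R boundary_word As)"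
    by (rule boundary_free_superset) (auto simp: in_keys_iff scaleR_poly_mapping.rep_eq)
  then show "boundary_free (c *\<^sub>R x) = c *\<^sub>R boundary_free x"
    by (simp add: boundary_free_def scaleR_poly_mapping.rep_eq scaleR_sum_right)
qed

lemma boundary_term_eq:
  assumes "As = xs @ P # ys @ Q # zs" "i = length xs" "j = length xs + length ys + 1"
  shows "boundary_term As i j =
    (-1) ^ (length xs + deg P * sum_list (map deg ys)) *\<^sub>R tri (xs @ ys @ bracket P Q # zs)"
proof -
  have Q: "As ! j = Q" using assms by (simp add: nth_append)
  have "(\<Sum>s\<in>{i<..<j}. deg (As ! s)) = (\<Sum>k<length ys. deg (ys ! k))"
    by (rule sum.reindex_bij_witness[where i = "\<lambda>k. k + i + 1" and j = "\<lambda>s. s - i - 1"])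
      (use assms in \<open>auto simp: nth_append nth_Cons'\<close>)
  also have "\<dots> = sum_list (map deg ys)"
    by (simp add: sum_list_sum_nth atLeast0LessThan)
  finally have s: "(\<Sum>s\<in>{i<..<j}. deg (As ! s)) = sum_list (map deg ys)" .
  show ?thesis
    unfolding boundary_term_def s Q using assms by (simp add: list_update_append)
qed

lemma split_one:
  assumes "i < length us"
  obtains xs P ys where "us = xs @ P # ys" "i = length xs"
proof
  show "us = take i us @ us ! i # drop (Suc i) us" using assms by (rule id_take_nth_drop)
qed (use assms in simp)

lemma split_two:
  assumes "i < j" "j < length us"
  obtains xs P ys Q zs where "us = xs @ P # ys @ Q # zs" "i = length xs"
    "j = length xs + length ys + 1"
proof -
  from assms have "i < length us" by simp
  then obtain xs P vs where 1: "us = xs @ P # vs" "i = length xs" by (rule split_one)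
  then have "j - i - 1 < length vs" using assms by auto
  then obtain ys Q zs where "vs = ys @ Q # zs" "j - i - 1 = length ys" by (rule split_one)
  with 1 assms that show ?thesis by auto
qed

lemma deg_part: "deg (part i p) = deg (part i q)"
  by (simp add: part_def)

lemma part_simps: "part 0 = Vect" "part (Suc 0) = Fn" "part 2 = Form"
  by (auto simp: part_def)

lemma part_cases:
  assumes "i \<le> 2"
  obtains "i = 0" | "i = 1" | "i = (2 :: nat)"
  using assms by linarith

lemma bracket_linear1:
  assumes "i \<le> 2"
  obtains k L where "k \<le> 2" "\<And>r. bracket (part i r) Q = part k (L r)"
    "\<And>a b p q. L (smult a p + smult b q) = smult a (L p) + smult b (L q)"
  using assms
proof (cases rule: part_cases)
  case 1
  show ?thesis
  proof (cases Q)
    case (Vect q)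
    show ?thesis
      by (rule that[of 0 "\<lambda>p. p * pderiv q - q * pderiv p"])
        (auto simp: 1 Vect part_simps pderiv_add pderiv_smult algebra_simps smult_add_right smult_diff_right)
  next
    case (Fn q)
    show ?thesis
      by (rule that[of 1 "\<lambda>p. p * pderiv q"])
        (auto simp: 1 Fn part_simps algebra_simps)
  next
    case (Form q)
    show ?thesis
      by (rule that[of 2 "\<lambda>p. pderiv (p * q)"])
        (auto simp: 1 Form part_simps pderiv_add pderiv_smult algebra_simps)
  qed
next
  case 2
  show ?thesis
  proof (cases Q)
    case (Vect q)
    show ?thesis
      by (rule that[of 1 "\<lambda>f. - (q * pderiv f)"])
        (auto simp: 2 Vect part_simps pderiv_add pderiv_smult algebra_simps)
  next
    case (Fn q)
    show ?thesis
      by (rule that[of 2 "\<lambda>p. pderiv (p * q)"])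
        (auto simp: 2 Fn part_simps pderiv_add pderiv_smult algebra_simps)
  next
    case (Form q)
    show ?thesis
      by (rule that[of 2 "\<lambda>p. 0"]) (auto simp: 2 Form part_simps)
  qed
next
  case 3
  show ?thesis
  proof (cases Q)
    case (Vect q)
    show ?thesis
      by (rule that[of 2 "\<lambda>f. - pderiv (q * f)"])
        (auto simp: 3 Vect part_simps pderiv_add pderiv_smult algebra_simps)
  next
    case (Fn q)
    show ?thesis
      by (rule that[of 2 "\<lambda>p. 0"]) (auto simp: 3 Fn part_simps)
  next
    case (Form q)
    show ?thesis
      by (rule that[of 2 "\<lambda>p. 0"]) (auto simp: 3 Form part_simps)
  qed
qed

lemma tri_uminus: "i \<le> 2 \<Longrightarrow> tri (us @ part i (- p) # vs) = - tri (us @ part i p # vs)"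
  using tri_multilinear[of i us "-1" p 0 0 vs] by simp

lemma tri_zero: "i \<le> 2 \<Longrightarrow> tri (us @ part i 0 # vs) = 0"
  using tri_multilinear[of i us 0 0 0 0 vs] by simp

lemma tri_neg:
  "tri (us @ Vect (- p) # vs) = - tri (us @ Vect p # vs)"
  "tri (us @ Fn (- p) # vs) = - tri (us @ Fn p # vs)"
  "tri (us @ Form (- p) # vs) = - tri (us @ Form p # vs)"
  using tri_uminus[of 0 us p vs] tri_uminus[of 1 us p vs] tri_uminus[of 2 us p vs]
  by (simp_all add: part_simps)

lemma tri_Form_0: "tri (us @ Form 0 # vs) = 0"
  using tri_zero[of 2 us vs] by (simp add: part_simps)

lemma tri_bracket_swap:
  "tri (us @ bracket A B # vs) = - ((-1) ^ (deg A * deg B) *\<^sub>R tri (us @ bracket B A # vs))"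
proof (cases A)
  case (Vect p)
  then show ?thesis
    using tri_neg(1)[of us "p * pderiv q - q * pderiv p" vs for q]
    by (cases B) (auto simp: tri_neg)
next
  case (Fn f)
  then show ?thesis by (cases B) (auto simp: tri_neg tri_Form_0 mult.commute[of f])
next
  case (Form q)
  then show ?thesis by (cases B) (auto simp: tri_neg tri_Form_0)
qed

lemma bracket_linear2:
  assumes "i \<le> 2"
  obtains k L where "k \<le> 2" "\<And>r. bracket Q (part i r) = part k (L r)"
    "\<And>a b p q. L (smult a p + smult b q) = smult a (L p) + smult b (L q)"
  using assms
proof (cases rule: part_cases)
  case 1
  show ?thesis
  proof (cases Q)
    case (Vect p)
    show ?thesis
      by (rule that[of 0 "\<lambda>r. p * pderiv r - r * pderiv p"])
        (auto simp: 1 Vect part_simps pderiv_add pderiv_smult algebra_simps smult_add_right smult_diff_right)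
  next
    case (Fn p)
    show ?thesis
      by (rule that[of 1 "\<lambda>r. - (r * pderiv p)"])
        (auto simp: 1 Fn part_simps pderiv_add pderiv_smult algebra_simps smult_add_right smult_diff_right)
  next
    case (Form p)
    show ?thesis
      by (rule that[of 2 "\<lambda>r. - pderiv (r * p)"])
        (auto simp: 1 Form part_simps pderiv_add pderiv_smult algebra_simps smult_add_right smult_diff_right)
  qed
next
  case 2
  show ?thesis
  proof (cases Q)
    case (Vect p)
    show ?thesis
      by (rule that[of 1 "\<lambda>r. p * pderiv r"])
        (auto simp: 2 Vect part_simps pderiv_add pderiv_smult algebra_simps smult_add_right smult_diff_right)
  next
    case (Fn p)
    show ?thesis
      by (rule that[of 2 "\<lambda>r. pderiv (p * r)"])
        (auto simp: 2 Fn part_simps pderiv_add pderiv_smult algebra_simps smult_add_right smult_diff_right)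
  next
    case (Form p)
    show ?thesis
      by (rule that[of 2 "\<lambda>r. 0"])
        (auto simp: 2 Form part_simps pderiv_add pderiv_smult algebra_simps smult_add_right smult_diff_right)
  qed
next
  case 3
  show ?thesis
  proof (cases Q)
    case (Vect p)
    show ?thesis
      by (rule that[of 2 "\<lambda>r. pderiv (p * r)"])
        (auto simp: 3 Vect part_simps pderiv_add pderiv_smult algebra_simps smult_add_right smult_diff_right)
  next
    case (Fn p)
    show ?thesis
      by (rule that[of 2 "\<lambda>r. 0"])
        (auto simp: 3 Fn part_simps pderiv_add pderiv_smult algebra_simps smult_add_right smult_diff_right)
  next
    case (Form p)
    show ?thesis
      by (rule that[of 2 "\<lambda>r. 0"])
        (auto simp: 3 Form part_simps pderiv_add pderiv_smult algebra_simps smult_add_right smult_diff_right)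
  qed
qed

lemma boundary_term_multilinear:
  assumes k: "k \<le> 2" and ij: "i < j" "j < length us + 1 + length vs"
  shows "boundary_term (us @ part k (smult a p + smult b q) # vs) i j =
    a *\<^sub>R boundary_term (us @ part k p # vs) i j + b *\<^sub>R boundary_term (us @ part k q # vs) i j"
proof -
  define W where "W r = us @ part k r # vs" for r
  have lin: ?thesis if l: "l \<le> 2"
    and L: "\<And>a b p q. L (smult a p + smult b q) = smult a (L p) + smult b (L q)"
    and t: "\<And>r. boundary_term (W r) i j = c *\<^sub>R tri (us' @ part l (L r) # vs')" for c l us' vs' L
  proof -
    have "boundary_term (W (smult a p + smult b q)) i j =
        a *\<^sub>R boundary_term (W p) i j + b *\<^sub>R boundary_term (W q) i j"
      unfolding t L tri_multilinear[OF l] by (simp add: scaleR_add_right mult.commute)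
    then show ?thesis by (simp add: W_def)
  qed
  consider "j < length us" | "j = length us" | "i < length us" "length us < j"
    | "i = length us" | "length us < i" by linarith
  then show ?thesis
  proof cases
    case 1
    with ij obtain xs P ys Q zs where s: "us = xs @ P # ys @ Q # zs" "i = length xs"
      "j = length xs + length ys + 1" using split_two by blast
    have "boundary_term (W r) i j = (-1) ^ (length xs + deg P * sum_list (map deg ys)) *\<^sub>R
        tri ((xs @ ys @ bracket P Q # zs) @ part k r # vs)" for r
      by (subst boundary_term_eq[of _ xs P ys Q "zs @ part k r # vs"]) (use s in \<open>auto simp: W_def\<close>)
    then show ?thesis by (rule lin[OF k refl])
  next
    case 2
    then have "i < length us" using ij by simp
    then obtain xs P ys where s: "us = xs @ P # ys" "i = length xs" by (rule split_one)
    obtain l L where L: "l \<le> 2" "\<And>r. bracket P (part k r) = part l (L r)"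
      "\<And>a b p q. L (smult a p + smult b q) = smult a (L p) + smult b (L q)"
      using bracket_linear2[OF k, of P] by blast
    have "boundary_term (W r) i j = (-1) ^ (length xs + deg P * sum_list (map deg ys)) *\<^sub>R
        tri ((xs @ ys) @ part l (L r) # vs)" for r
      by (subst boundary_term_eq[of _ xs P ys "part k r" vs]) (use s 2 L(2) in \<open>auto simp: W_def\<close>)
    then show ?thesis by (rule lin[OF L(1,3)])
  next
    case 3
    obtain xs P ys where s: "us = xs @ P # ys" "i = length xs" using 3(1) by (rule split_one)
    have "j - length us - 1 < length vs" using 3 ij by simp
    then obtain ws Q zs where t: "vs = ws @ Q # zs" "j - length us - 1 = length ws" by (rule split_one)
    have "boundary_term (W r) i j = (-1) ^ (length xs + deg P *
        sum_list (map deg (ys @ part k 0 # ws))) *\<^sub>R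
        tri ((xs @ ys) @ part k r # ws @ bracket P Q # zs)" for r
      by (subst boundary_term_eq[of _ xs P "ys @ part k r # ws" Q zs])
        (use s t 3 in \<open>auto simp: W_def deg_part[of k r 0]\<close>)
    then show ?thesis by (rule lin[OF k refl])
  next
    case 4
    have "j - length us - 1 < length vs" using 4 ij by simp
    then obtain ws Q zs where t: "vs = ws @ Q # zs" "j - length us - 1 = length ws" by (rule split_one)
    obtain l L where L: "l \<le> 2" "\<And>r. bracket (part k r) Q = part l (L r)"
      "\<And>a b p q. L (smult a p + smult b q) = smult a (L p) + smult b (L q)"
      using bracket_linear1[OF k, of Q] by blast
    have "boundary_term (W r) i j = (-1) ^ (length us + deg (part k 0) * sum_list (map deg ws)) *\<^sub>R
        tri ((us @ ws) @ part l (L r) # zs)" for r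
      by (subst boundary_term_eq[of _ us "part k r" ws Q zs])
        (use t 4 ij L(2) in \<open>auto simp: W_def deg_part[of k r 0]\<close>)
    then show ?thesis by (rule lin[OF L(1,3)])
  next
    case 5
    have "i - length us - 1 < j - length us - 1" "j - length us - 1 < length vs" using 5 ij by auto
    then obtain xs P ys Q zs where s: "vs = xs @ P # ys @ Q # zs" "i - length us - 1 = length xs"
      "j - length us - 1 = length xs + length ys + 1" by (rule split_two)
    let ?c = "(-1) ^ (length us + 1 + length xs + deg P * sum_list (map deg ys)) :: real"
    have "boundary_term (W r) i j = ?c *\<^sub>R
        tri (us @ part k r # xs @ ys @ bracket P Q # zs)" for r
      by (subst boundary_term_eq[of _ "us @ part k r # xs" P ys Q zs])
        (use s 5 ij in \<open>auto simp: W_def\<close>)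
    then show ?thesis by (rule lin[OF k refl])
  qed
qed

lemma finite_pairs: "finite {(i, j). i < j \<and> j < (n :: nat)}"
  by (rule finite_subset[of _ "{..<n} \<times> {..<n}"]) auto

lemma boundary_word_multilinear:
  assumes "k \<le> 2"
  shows "boundary_word (us @ part k (smult a p + smult b q) # vs) =
    a *\<^sub>R boundary_word (us @ part k p # vs) + b *\<^sub>R boundary_word (us @ part k q # vs)"
proof -
  have len: "length (us @ part k r # vs) = length us + 1 + length vs" for r by simp
  show ?thesis
    unfolding boundary_word_def len scaleR_sum_right sum.distrib[symmetric]
    by (rule sum.cong) (auto simp: boundary_term_multilinear[OF assms])
qed

lemma deg_bracket: "deg (bracket A B) = deg A + deg B \<or> bracket A B = Form 0"
  by (cases A; cases B) auto

lemma tri_swap_bracket1: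
  "tri (us @ bracket P A # B # vs) =
    - ((-1) ^ ((deg P + deg A) * deg B) *\<^sub>R tri (us @ B # bracket P A # vs))"
  using deg_bracket[of P A] tri_supercommute[of us "bracket P A" B vs]
    tri_Form_0[of us "B # vs"] tri_Form_0[of "us @ [B]" vs] by auto

lemma tri_swap_bracket2:
  "tri (us @ A # bracket P B # vs) =
    - ((-1) ^ (deg A * (deg P + deg B)) *\<^sub>R tri (us @ bracket P B # A # vs))"
  using deg_bracket[of P B] tri_supercommute[of us A "bracket P B" vs]
    tri_Form_0[of us "A # vs"] tri_Form_0[of "us @ [A]" vs] by auto

lemma boundary_term_swap:
  assumes ij: "i < j" "j < length us + 2 + length vs"
    and ne: "(i, j) \<noteq> (length us, length us + 1)"
  shows "boundary_term (us @ A # B # vs) i j = - ((-1) ^ (deg A * deg B) *\<^sub>R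
    boundary_term (us @ B # A # vs) (Transposition.transpose (length us) (length us + 1) i)
      (Transposition.transpose (length us) (length us + 1) j))"
proof -
  let ?n = "length us" and ?t = "Transposition.transpose (length us) (length us + 1)"
  consider "j < ?n" | "j = ?n" | "j = ?n + 1" "i < ?n" | "i < ?n" "?n + 1 < j"
    | "i = ?n" "?n + 1 < j" | "i = ?n + 1" | "?n + 1 < i" using ij ne by fastforce
  then show ?thesis
  proof cases
    case 1
    with ij obtain xs P ys Q zs where s: "us = xs @ P # ys @ Q # zs" "i = length xs"
      "j = length xs + length ys + 1" using split_two by blast
    have "?t i = i" "?t j = j" using 1 ij by (auto simp: Transposition.transpose_def)
    moreover have "boundary_term (us @ A # B # vs) i j =
        (-1) ^ (length xs + deg P * sum_list (map deg ys)) *\<^sub>R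
        tri ((xs @ ys @ bracket P Q # zs) @ A # B # vs)"
      by (subst boundary_term_eq[of _ xs P ys Q "zs @ A # B # vs"]) (use s in auto)
    moreover have "boundary_term (us @ B # A # vs) i j =
        (-1) ^ (length xs + deg P * sum_list (map deg ys)) *\<^sub>R
        tri ((xs @ ys @ bracket P Q # zs) @ B # A # vs)"
      by (subst boundary_term_eq[of _ xs P ys Q "zs @ B # A # vs"]) (use s in auto)
    ultimately show ?thesis
      by (simp only: tri_supercommute[of _ A B] scaleR_minus_right scaleR_left_commute)
  next
    case 2
    then have "i < length us" using ij by simp
    then obtain xs P ys where s: "us = xs @ P # ys" "i = length xs" by (rule split_one)
    have "?t i = i" "?t j = j + 1" using 2 ij by (auto simp: Transposition.transpose_def)
    moreover have "boundary_term (us @ A # B # vs) i j =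
        (-1) ^ (length xs + deg P * sum_list (map deg ys)) *\<^sub>R
        tri ((xs @ ys) @ bracket P A # B # vs)"
      by (subst boundary_term_eq[of _ xs P ys A "B # vs"]) (use s 2 in auto)
    moreover have "boundary_term (us @ B # A # vs) i (j + 1) =
        (-1) ^ (length xs + deg P * sum_list (map deg (ys @ [B]))) *\<^sub>R
        tri ((xs @ ys) @ B # bracket P A # vs)"
      by (subst boundary_term_eq[of _ xs P "ys @ [B]" A vs]) (use s 2 in auto)
    ultimately show ?thesis
      by (simp add: tri_swap_bracket1[of "xs @ ys", simplified] power_add algebra_simps)
  next
    case 3
    obtain xs P ys where s: "us = xs @ P # ys" "i = length xs" using 3(2) by (rule split_one)
    have "?t i = i" "?t j = ?n" using 3 ij by (auto simp: Transposition.transpose_def)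
    moreover have "boundary_term (us @ A # B # vs) i j =
        (-1) ^ (length xs + deg P * sum_list (map deg (ys @ [A]))) *\<^sub>R
        tri ((xs @ ys) @ A # bracket P B # vs)"
      by (subst boundary_term_eq[of _ xs P "ys @ [A]" B vs]) (use s 3 in auto)
    moreover have "boundary_term (us @ B # A # vs) i ?n =
        (-1) ^ (length xs + deg P * sum_list (map deg ys)) *\<^sub>R
        tri ((xs @ ys) @ bracket P B # A # vs)"
      by (subst boundary_term_eq[of _ xs P ys B "A # vs"]) (use s 3 in auto)
    moreover have "(-1) ^ (deg P * deg A) * (-1) ^ (deg P * deg A) = (1 :: real)"
      by (simp flip: power_add)
    ultimately show ?thesis
      by (simp add: tri_swap_bracket2[of "xs @ ys", simplified] power_add algebra_simps)
  next
    case 4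
    obtain xs P ys where s: "us = xs @ P # ys" "i = length xs" using 4(1) by (rule split_one)
    have "j - ?n - 2 < length vs" using 4 ij by simp
    then obtain ws Q zs where t: "vs = ws @ Q # zs" "j - ?n - 2 = length ws" by (rule split_one)
    let ?c = "(-1) ^ (length xs + deg P * sum_list (map deg (ys @ A # B # ws))) :: real"
    have "?t i = i" "?t j = j" using 4 ij by (auto simp: Transposition.transpose_def)
    moreover have "boundary_term (us @ A # B # vs) i j =
        ?c *\<^sub>R tri ((xs @ ys) @ A # B # ws @ bracket P Q # zs)"
      by (subst boundary_term_eq[of _ xs P "ys @ A # B # ws" Q zs]) (use s t 4 in auto)
    moreover have "boundary_term (us @ B # A # vs) i j =
        ?c *\<^sub>R tri ((xs @ ys) @ B # A # ws @ bracket P Q # zs)"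
      by (subst boundary_term_eq[of _ xs P "ys @ B # A # ws" Q zs])
        (use s t 4 in \<open>auto simp: add.left_commute\<close>)
    ultimately show ?thesis
      by (simp only: tri_supercommute[of _ A B] scaleR_minus_right scaleR_left_commute)
  next
    case 5
    have "j - ?n - 2 < length vs" using 5 ij by simp
    then obtain ws Q zs where t: "vs = ws @ Q # zs" "j - ?n - 2 = length ws" by (rule split_one)
    have "?t i = i + 1" "?t j = j" using 5 ij by (auto simp: Transposition.transpose_def)
    moreover have "boundary_term (us @ A # B # vs) i j =
        (-1) ^ (?n + deg A * sum_list (map deg (B # ws))) *\<^sub>R
        tri (us @ (B # ws) @ bracket A Q # zs)"
      by (subst boundary_term_eq[of _ us A "B # ws" Q zs]) (use t 5 in auto)
    moreover have "boundary_term (us @ B # A # vs) (i + 1) j =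
        (-1) ^ (?n + 1 + deg A * sum_list (map deg ws)) *\<^sub>R
        tri (us @ B # ws @ bracket A Q # zs)"
      by (subst boundary_term_eq[of _ "us @ [B]" A ws Q zs]) (use t 5 in auto)
    ultimately show ?thesis by (simp add: power_add algebra_simps)
  next
    case 6
    have "j - ?n - 2 < length vs" using 6 ij by simp
    then obtain ws Q zs where t: "vs = ws @ Q # zs" "j - ?n - 2 = length ws" by (rule split_one)
    have "?t i = ?n" "?t j = j" using 6 ij by (auto simp: Transposition.transpose_def)
    moreover have "boundary_term (us @ A # B # vs) i j =
        (-1) ^ (?n + 1 + deg B * sum_list (map deg ws)) *\<^sub>R
        tri (us @ A # ws @ bracket B Q # zs)"
      by (subst boundary_term_eq[of _ "us @ [A]" B ws Q zs]) (use t 6 ij in auto)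
    moreover have "boundary_term (us @ B # A # vs) ?n j =
        (-1) ^ (?n + deg B * sum_list (map deg (A # ws))) *\<^sub>R
        tri (us @ (A # ws) @ bracket B Q # zs)"
      by (subst boundary_term_eq[of _ us B "A # ws" Q zs]) (use t 6 ij in auto)
    moreover have "(-1) ^ (deg A * deg B) * (-1) ^ (deg A * deg B) = (1 :: real)"
      by (simp flip: power_add)
    ultimately show ?thesis by (simp add: power_add algebra_simps)
  next
    case 7
    have "i - ?n - 2 < j - ?n - 2" "j - ?n - 2 < length vs" using 7 ij by auto
    then obtain xs P ys Q zs where s: "vs = xs @ P # ys @ Q # zs" "i - ?n - 2 = length xs"
      "j - ?n - 2 = length xs + length ys + 1" by (rule split_two)
    let ?c = "(-1) ^ (?n + 2 + length xs + deg P * sum_list (map deg ys)) :: real"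
    have "?t i = i" "?t j = j" using 7 ij by (auto simp: Transposition.transpose_def)
    moreover have "boundary_term (us @ A # B # vs) i j =
        ?c *\<^sub>R tri (us @ A # B # xs @ ys @ bracket P Q # zs)"
      by (subst boundary_term_eq[of _ "us @ A # B # xs" P ys Q zs]) (use s 7 ij in auto)
    moreover have "boundary_term (us @ B # A # vs) i j =
        ?c *\<^sub>R tri (us @ B # A # xs @ ys @ bracket P Q # zs)"
      by (subst boundary_term_eq[of _ "us @ B # A # xs" P ys Q zs]) (use s 7 ij in auto)
    ultimately show ?thesis
      by (simp only: tri_supercommute[of _ A B] scaleR_minus_right scaleR_left_commute)
  qed
qed

lemma boundary_word_supercommute:
  "boundary_word (us @ A # B # vs) = - ((-1) ^ (deg A * deg B) *\<^sub>R boundary_word (us @ B # A # vs))"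
proof -
  let ?n = "length us" and ?t = "Transposition.transpose (length us) (length us + 1)"
  let ?m = "length us + 2 + length vs" and ?e = "(-1) ^ (deg A * deg B) :: real"
  let ?S = "{(i, j). i < j \<and> j < ?m}" and ?S' = "{(i, j). i < j \<and> j < ?m} - {(?n, ?n + 1)}"
  have S: "finite ?S" "(?n, ?n + 1) \<in> ?S" by (rule finite_pairs) simp
  have AB: "boundary_word (us @ A # B # vs) = boundary_term (us @ A # B # vs) ?n (?n + 1) +
      (\<Sum>(i, j)\<in>?S'. boundary_term (us @ A # B # vs) i j)" for A B
    unfolding boundary_word_def using sum.remove[OF S, of "\<lambda>(i, j). boundary_term (us @ A # B # vs) i j"]
    by (simp add: add.assoc)
  have 1: "boundary_term (us @ A # B # vs) ?n (?n + 1) =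
      - (?e *\<^sub>R boundary_term (us @ B # A # vs) ?n (?n + 1))"
    using boundary_term_eq[of "us @ A # B # vs" us A "[]" B vs ?n "?n + 1"]
      boundary_term_eq[of "us @ B # A # vs" us B "[]" A vs ?n "?n + 1"] tri_bracket_swap[of us A B vs]
    by simp
  have "(\<Sum>(i, j)\<in>?S'. boundary_term (us @ A # B # vs) i j) =
      (\<Sum>(i, j)\<in>?S'. - (?e *\<^sub>R boundary_term (us @ B # A # vs) (?t i) (?t j)))"
  proof (rule sum.cong)
    fix x assume x: "x \<in> ?S'"
    obtain i j where "x = (i, j)" by fastforce
    with x show "(case x of (i, j) \<Rightarrow> boundary_term (us @ A # B # vs) i j) =
        (case x of (i, j) \<Rightarrow> - (?e *\<^sub>R boundary_term (us @ B # A # vs) (?t i) (?t j)))"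
      using boundary_term_swap[of i j us vs A B] by simp
  qed simp
  also have "\<dots> = (\<Sum>(i, j)\<in>?S'. - (?e *\<^sub>R boundary_term (us @ B # A # vs) i j))"
    by (rule sum.reindex_bij_witness[where i = "map_prod ?t ?t" and j = "map_prod ?t ?t"])
      (auto simp: Transposition.transpose_def split: if_splits)
  also have "\<dots> = - (?e *\<^sub>R (\<Sum>(i, j)\<in>?S'. boundary_term (us @ B # A # vs) i j))"
    by (simp add: scaleR_sum_right sum_negf case_prod_unfold)
  finally show ?thesis unfolding AB 1 by (simp add: scaleR_add_right)
qed

lemma boundary_free_relations:
  assumes "x \<in> span chain_relations"
  shows "boundary_free x = 0"
proof (rule linear_eq_0_on_span[OF linear_boundary_free _ assms])
  fix r assume "r \<in> chain_relations"
  then show "boundary_free r = 0"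
  proof cases
    case (multilinear i us a p b q vs)
    then show ?thesis
      by (simp add: linear_diff[OF linear_boundary_free] linear_scale[OF linear_boundary_free]
        boundary_word_multilinear)
  next
    case (supercommute us A B vs)
    then show ?thesis
      using boundary_word_supercommute[of us A B vs]
      by (simp add: linear_add[OF linear_boundary_free] linear_scale[OF linear_boundary_free])
  qed
qed

lift_definition boundary :: "chain \<Rightarrow> chain" is boundary_free
proof -
  fix x y :: "elem list \<Rightarrow>\<^sub>0 real"
  assume "x - y \<in> span chain_relations"
  then have "boundary_free (x - y) = 0" by (rule boundary_free_relations)
  then show "boundary_free x = boundary_free y" by (simp add: linear_diff[OF linear_boundary_free])
qed

lemma boundary_tri: "boundary (tri As) = boundary_word As"
  by (simp add: tri_def boundary.abs_eq)


section \<open>Weights and Betti numbers\<close>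

text \<open>A list of pairs \<open>(i, j)\<close> records the summand to which each factor belongs.\<close>

definition chain_space :: "nat \<Rightarrow> nat \<Rightarrow> int \<Rightarrow> chain set" where
  "chain_space m w h = span {tri As | As ijs.
    length As = m \<and> list_all2 (\<lambda>A (i, j). i \<le> 2 \<and> A \<in> component i j) As ijs \<and>
    (\<Sum>(i, j)\<leftarrow>ijs. i) = w \<and> - int m + (\<Sum>(i, j)\<leftarrow>ijs. int j) = h}"

text \<open>Dimension of the quotient \<open>V / W\<close>: the length \<open>d\<close> of a finite family in \<open>V\<close> whose
  classes form a basis of the quotient.\<close>

definition quotient_dim :: "'a::real_vector set \<Rightarrow> 'a set \<Rightarrow> nat" where
  "quotient_dim V W = (THE d. \<exists>e :: nat \<Rightarrow> 'a. (\<forall>k<d. e k \<in> V) \<and>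
    (\<forall>v\<in>V. \<exists>!c. c \<in> {..<d} \<rightarrow>\<^sub>E UNIV \<and> v - (\<Sum>k<d. c k *\<^sub>R e k) \<in> W))"

definition betti :: "nat \<Rightarrow> nat \<Rightarrow> int \<Rightarrow> nat" where
  "betti m w h = quotient_dim {c \<in> chain_space m w h. boundary c = 0}
    (boundary ` chain_space (m + 1) w h)"

end

(* Up to sign, the space C_{m,w,-w} is spanned by the finitely many monomial words of the right
   weights, and the boundary of a monomial word is a combination of monomial words. Independence
   of monomial words in the quotient is detected by functionals: contraction with a letter is
   transposed to left multiplication and respects the relations, so iterated contraction along a
   word gives a functional on chains that vanishes on every other ordered monomial word. *)
theory Submission
  imports Defs
begin

section \<open>Monomial words spanning the chain spaces\<close>

text \<open>The complexes are small for a combinatorial reason. In length m and double weight (w,-w)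
  the exponents of a word add up to m - w. If v of the letters are vector fields, the other m - v
  letters have degree at least 1, so m - v <= w and the total exponent is at most v. Distinct vector
  fields have distinct exponents, so their exponents already add up to at least v(v-1)/2. Hence v <=
  3 and m <= w + 3, and enumeration leaves 17 words for the three weights. The obstacle is that
  \<open>chain\<close> is a quotient by a generated subspace: spanning sets come from rewriting, but
  no normal form or basis is given, so even the nonvanishing of a single word needs a functional
  proved to be well defined. A full basis theorem is avoided; only the few coordinates that the rank
  computations require are evaluated.\<close>

definition mono_elem :: "nat \<times> nat \<Rightarrow> elem" where
  "mono_elem = (\<lambda>(i, j). part i (monom 1 j))"

definition word :: "(nat \<times> nat) list \<Rightarrow> chain" where
  "word ts = tri (map mono_elem ts)"

lemma part_ge_2: "2 \<le> i \<Longrightarrow> part i = part 2"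
  by (auto simp: part_def)

text \<open>No bound on \<open>i\<close> is imposed, because it is applied with \<open>i\<close> the
  sum of two degrees, which can reach 4; every \<open>part i\<close> with \<open>i\<close> at least
  2 gives 1-forms.\<close>

lemma tri_smult: "tri (us @ part i (smult c p) # vs) = c *\<^sub>R tri (us @ part i p # vs)"
proof (cases "i \<le> 2")
  case True
  then show ?thesis using tri_multilinear[of i us c p 0 0 vs] by simp
next
  case False
  then show ?thesis using tri_multilinear[of 2 us c p 0 0 vs] by (simp add: part_ge_2[of i])
qed

lemma deg_mono_elem: "deg (mono_elem (i, j)) = min i 2"
  by (auto simp: mono_elem_def part_def)

text \<open>The sign is left anonymous since only membership in spans is at stake. The prefix
  \<open>us\<close> absorbs the letters that the induction passes.\<close>

lemma tri_move_front: "\<exists>c. tri (us @ ws @ A # vs) = c *\<^sub>R tri (us @ A # ws @ vs)"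
proof (induction ws arbitrary: us)
  case Nil
  show ?case by (rule exI[of _ 1]) simp
next
  case (Cons B ws)
  obtain c where "tri (us @ B # ws @ A # vs) = c *\<^sub>R tri (us @ B # A # ws @ vs)"
    using Cons[of "us @ [B]"] by auto
  then show ?case using tri_supercommute[of us B A "ws @ vs"]
    by (intro exI[of _ "- c * (-1) ^ (deg B * deg A)"]) simp
qed

lemma tri_move_mono_front:
  assumes "t \<in> set ts"
  obtains c where "tri (us @ map mono_elem ts) =
    c *\<^sub>R tri (us @ mono_elem t # map mono_elem (remove1 t ts))"
proof -
  obtain xs ys where s: "ts = xs @ t # ys" "t \<notin> set xs"
    using split_list_first[OF assms] by blast
  then have "remove1 t ts = xs @ ys" by (simp add: remove1_append)
  with s show ?thesis
    using tri_move_front[of us "map mono_elem xs" "mono_elem t" "map mono_elem ys"] that by auto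
qed

lemma tri_repeat_even:
  assumes "even (deg A)"
  shows "tri (us @ A # A # vs) = 0"
proof -
  have "tri (us @ A # A # vs) = - tri (us @ A # A # vs)"
    using tri_supercommute[of us A A vs] assms by simp
  then have "2 *\<^sub>R tri (us @ A # A # vs) = 0" by (metis scaleR_2 add.right_inverse)
  then show ?thesis by simp
qed

lemma word_repeat_Vect: "word ((0, j) # (0, j) # ts) = 0"
  using tri_repeat_even[of "mono_elem (0, j)" "[]"] by (simp add: word_def deg_mono_elem)

text \<open>Up to sign, every monomial word can be written along a fixed list of letters; only letters of
  odd degree may be repeated. \<open>m\<close>, \<open>w\<close>, \<open>s\<close> are the length and the sums of the degrees and of the
  exponents.\<close>

fun words :: "(nat \<times> nat) list \<Rightarrow> nat \<Rightarrow> nat \<Rightarrow> nat \<Rightarrow> (nat \<times> nat) list list" where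
  "words [] m w s = (if m = 0 \<and> w = 0 \<and> s = 0 then [[]] else [])"
| "words ((i, j) # ts) m w s =
    (if 0 < m \<and> i \<le> w \<and> j \<le> s
     then map ((#) (i, j)) (words (if odd i then (i, j) # ts else ts) (m - 1) (w - i) (s - j))
     else []) @ words ts m w s"

lemma words_sound:
  assumes "u \<in> set (words ts m w s)"
  shows "set u \<subseteq> set ts \<and> length u = m \<and> (\<Sum>(i, j)\<leftarrow>u. i) = w \<and> (\<Sum>(i, j)\<leftarrow>u. j) = s"
  using assms
proof (induction ts m w s arbitrary: u rule: words.induct)
  case (2 i j ts m w s)
  show ?case
  proof (cases "u \<in> set (words ts m w s)")
    case True
    then show ?thesis using "2.IH"(2) by (metis insert_iff list.set(2) subset_iff)
  next
    case False
    then have "u \<in> set (if 0 < m \<and> i \<le> w \<and> j \<le> s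
        then map ((#) (i, j)) (words (if odd i then (i, j) # ts else ts) (m - 1) (w - i) (s - j))
        else [])"
      using "2.prems" by (simp only: words.simps set_append Un_iff simp_thms)
    then obtain v where c: "0 < m \<and> i \<le> w \<and> j \<le> s" and v: "u = (i, j) # v"
      "v \<in> set (words (if odd i then (i, j) # ts else ts) (m - 1) (w - i) (s - j))"
      by (cases "0 < m \<and> i \<le> w \<and> j \<le> s") (simp_all only: simp_thms if_True if_False
        list.set empty_iff set_map image_iff, blast)
    have "set v \<subseteq> set ((i, j) # ts) \<and> length v = m - 1 \<and>
        (\<Sum>(i, j)\<leftarrow>v. i) = w - i \<and> (\<Sum>(i, j)\<leftarrow>v. j) = s - j"
      using "2.IH"(1)[OF c v(2)] by (cases "odd i") auto
    with c show ?thesis unfolding v(1) by simp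
  qed
qed (simp split: if_splits)

declare words.simps(2) [simp del]

text \<open>The induction follows the recursion of \<open>words\<close>: a head letter that occurs
  in \<open>us\<close> is moved to the front and then split off, otherwise it is discarded. The
  prefix \<open>pre\<close> stores the letters already split off, so that the induction hypothesis
  applies behind them.\<close>

lemma words_complete:
  assumes "set us \<subseteq> set ts" "\<forall>(i, j)\<in>set ts. i \<le> 2"
    "length us = m" "(\<Sum>(i, j)\<leftarrow>us. i) = w" "(\<Sum>(i, j)\<leftarrow>us. j) = s"
  shows "tri (pre @ map mono_elem us) \<in>
    span ((\<lambda>u. tri (pre @ map mono_elem u)) ` set (words ts m w s))"
  using assms
proof (induction ts m w s arbitrary: us pre rule: words.induct)
  case (1 m w s)
  then show ?case by (auto intro!: span_base)
next
  case (2 i j ts m w s)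
  let ?t = "(i, j)" and ?ts = "if odd i then (i, j) # ts else ts"
  show ?case
  proof (cases "?t \<in> set us")
    case False
    have "tri (pre @ map mono_elem us) \<in>
        span ((\<lambda>u. tri (pre @ map mono_elem u)) ` set (words ts m w s))"
      using False "2.prems" by (intro "2.IH"(2)) auto
    moreover have "set (words ts m w s) \<subseteq> set (words (?t # ts) m w s)"
      by (simp add: words.simps(2))
    ultimately show ?thesis using span_mono[OF image_mono] by blast
  next
    case True
    let ?us = "remove1 ?t us"
    have f: "(\<Sum>(a, b)\<leftarrow>us. a) = i + (\<Sum>(a, b)\<leftarrow>?us. a)"
      "(\<Sum>(a, b)\<leftarrow>us. b) = j + (\<Sum>(a, b)\<leftarrow>?us. b)"
      using sum_list_map_remove1[OF True, of "\<lambda>(a, b). a"]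
        sum_list_map_remove1[OF True, of "\<lambda>(a, b). b"] by (simp_all only: prod.case)
    have "0 < length us" using True by (rule length_pos_if_in_set)
    then have c: "0 < m \<and> i \<le> w \<and> j \<le> s"
      using f "2.prems"(3-5) by linarith
    obtain c where e: "tri (pre @ map mono_elem us) =
        c *\<^sub>R tri (pre @ mono_elem ?t # map mono_elem ?us)"
      using tri_move_mono_front[OF True] .
    have "tri (pre @ mono_elem ?t # map mono_elem ?us) \<in>
        span ((\<lambda>u. tri (pre @ map mono_elem u)) ` set (words (?t # ts) m w s))"
    \<comment> \<open>A second copy of a letter of even degree can be brought next to the first,
      which makes the product zero; this justifies that \<open>words\<close> drops such a letter
      after one use.\<close>
    proof (cases "even i \<and> ?t \<in> set ?us")
      case True
      then obtain d where "tri ((pre @ [mono_elem ?t]) @ map mono_elem ?us) =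
          d *\<^sub>R tri ((pre @ [mono_elem ?t]) @ mono_elem ?t # map mono_elem (remove1 ?t ?us))"
        using tri_move_mono_front by blast
      moreover have "even (deg (mono_elem ?t))" using True by (simp add: deg_mono_elem min_def)
      ultimately show ?thesis by (simp add: tri_repeat_even span_zero)
    next
      case False
      have "set ?us \<subseteq> set ?ts"
        using False "2.prems"(1) set_remove1_subset[of ?t us] by (auto split: if_splits)
      moreover have "\<forall>(i, j)\<in>set ?ts. i \<le> 2" using "2.prems"(2) by auto
      moreover have "length ?us = m - 1" using True "2.prems"(3) by (simp add: length_remove1)
      ultimately have "tri ((pre @ [mono_elem ?t]) @ map mono_elem ?us) \<in>
          span ((\<lambda>u. tri ((pre @ [mono_elem ?t]) @ map mono_elem u)) `
            set (words ?ts (m - 1) (w - i) (s - j)))"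
        using f "2.prems"(4,5) by (intro "2.IH"(1)[OF c]) linarith+
      moreover have "(\<lambda>u. tri ((pre @ [mono_elem ?t]) @ map mono_elem u)) `
            set (words ?ts (m - 1) (w - i) (s - j)) \<subseteq>
          (\<lambda>u. tri (pre @ map mono_elem u)) ` set (words (?t # ts) m w s)"
      proof
        fix x assume "x \<in> (\<lambda>u. tri ((pre @ [mono_elem ?t]) @ map mono_elem u)) `
          set (words ?ts (m - 1) (w - i) (s - j))"
        then obtain u where u: "u \<in> set (words ?ts (m - 1) (w - i) (s - j))"
          "x = tri (pre @ map mono_elem (?t # u))"
          by (simp only: append_assoc append_Cons append_Nil list.map) blast
        from u(1) c have "?t # u \<in> set (words (?t # ts) m w s)"
          by (simp only: words.simps(2) simp_thms if_True set_append set_map) blast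
        with u(2) show "x \<in> (\<lambda>u. tri (pre @ map mono_elem u)) ` set (words (?t # ts) m w s)"
          by blast
      qed
      ultimately have "tri ((pre @ [mono_elem ?t]) @ map mono_elem ?us) \<in>
          span ((\<lambda>u. tri (pre @ map mono_elem u)) ` set (words (?t # ts) m w s))"
        using span_mono by (meson subsetD)
      then show ?thesis by (simp only: append_assoc append_Cons append_Nil)
    qed
    then show ?thesis unfolding e by (rule span_scale)
  qed
qed

lemma tri_components:
  assumes "list_all2 (\<lambda>A (i, j). i \<le> 2 \<and> A \<in> component i j) As ijs"
  shows "\<exists>c. tri (us @ As) = c *\<^sub>R tri (us @ map mono_elem ijs)"
  using assms
proof (induction arbitrary: us rule: list_all2_induct)
  case Nil
  show ?case by (rule exI[of _ 1]) simp
next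
  case (Cons A As t ts)
  then obtain i j c where t: "t = (i, j)" "A = part i (smult c (monom 1 j))"
    by (cases t) (auto simp: component_def smult_monom)
  obtain d where "tri ((us @ [A]) @ As) = d *\<^sub>R tri ((us @ [A]) @ map mono_elem ts)"
    using Cons by blast
  then show ?case
    using tri_smult[of us i c "monom 1 j" "map mono_elem ts"]
    by (intro exI[of _ "d * c"]) (simp add: t mono_elem_def)
qed

text \<open>Exponents are natural numbers, so in a word of total exponent \<open>s\<close> none
  exceeds \<open>s\<close>. The order is by degree, then by exponent.\<close>

definition letters :: "nat \<Rightarrow> (nat \<times> nat) list" where
  "letters s = List.product [0, 1, 2] [0..<Suc s]"

lemma sum_list_snd_nonneg: "(i, j) \<in> set u \<Longrightarrow> j \<le> (\<Sum>(i, j)\<leftarrow>u. j :: nat)"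
  by (induction u) auto

text \<open>Secondary weight \<open>h\<close> in length \<open>m\<close> means total exponent
  \<open>s\<close>. Scalars are extracted from the factors by \<open>tri_components\<close> and the
  letters sorted by \<open>words_complete\<close>; conversely \<open>words_sound\<close> shows that
  each listed word is a generator of the chain space.\<close>

lemma chain_space_words:
  assumes "h = int s - int m"
  shows "chain_space m w h = span (word ` set (words (letters s) m w s))"
proof -
  have int_sum: "(\<Sum>(i, j)\<leftarrow>u. int j) = int (\<Sum>(i, j)\<leftarrow>u. j)" for u :: "(nat \<times> nat) list"
    by (induction u) auto
  let ?G = "{tri As | As ijs.
    length As = m \<and> list_all2 (\<lambda>A (i, j). i \<le> 2 \<and> A \<in> component i j) As ijs \<and>
    (\<Sum>(i, j)\<leftarrow>ijs. i) = w \<and> - int m + (\<Sum>(i, j)\<leftarrow>ijs. int j) = h}"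
  have "?G \<subseteq> span (word ` set (words (letters s) m w s))"
  proof clarify
    fix As ijs
    assume a: "m = length As" "list_all2 (\<lambda>A (i, j). i \<le> 2 \<and> A \<in> component i j) As ijs"
      "w = (\<Sum>(i, j)\<leftarrow>ijs. i)" "h = - int (length As) + (\<Sum>(i, j)\<leftarrow>ijs. int j)"
    obtain c where c: "tri ([] @ As) = c *\<^sub>R tri ([] @ map mono_elem ijs)"
      using tri_components[OF a(2)] by blast
    have s: "(\<Sum>(i, j)\<leftarrow>ijs. j) = s" using a(1,4) assms unfolding int_sum by simp
    have "\<forall>(i, j)\<in>set ijs. i \<le> 2"
      using a(2) by (auto simp: list_all2_conv_all_nth in_set_conv_nth) fastforce
    then have "set ijs \<subseteq> set (letters s)"
      using sum_list_snd_nonneg[of _ _ ijs] s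
      by (fastforce simp: letters_def less_Suc_eq_le le_Suc_eq numeral_2_eq_2)
    then have "tri ([] @ map mono_elem ijs) \<in>
        span ((\<lambda>u. tri ([] @ map mono_elem u)) ` set (words (letters s) m w s))"
      using a s list_all2_lengthD[OF a(2)]
      by (intro words_complete) (auto simp: letters_def)
    then show "tri As \<in> span (word ` set (words (letters s) (length As) (\<Sum>(i, j)\<leftarrow>ijs. i) s))"
      using c a(1,3) by (simp add: word_def[abs_def] span_scale)
  qed
  moreover have "word ` set (words (letters s) m w s) \<subseteq> ?G"
  proof clarify
    fix u assume "u \<in> set (words (letters s) m w s)"
    from words_sound[OF this]
    have u: "set u \<subseteq> set (letters s)" "length u = m" "(\<Sum>(i, j)\<leftarrow>u. i) = w" "(\<Sum>(i, j)\<leftarrow>u. j) = s"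
      by auto
    have "list_all2 (\<lambda>A (i, j). i \<le> 2 \<and> A \<in> component i j) (map mono_elem u) u"
      using u(1) by (auto simp: list_all2_conv_all_nth letters_def mono_elem_def component_def
          dest!: nth_mem split: prod.splits)
    with u assms show "\<exists>As ijs. word u = tri As \<and> length As = m \<and>
        list_all2 (\<lambda>A (i, j). i \<le> 2 \<and> A \<in> component i j) As ijs \<and>
        (\<Sum>(i, j)\<leftarrow>ijs. i) = w \<and> - int m + (\<Sum>(i, j)\<leftarrow>ijs. int j) = h"
      unfolding int_sum word_def by (intro exI[of _ "map mono_elem u"] exI[of _ u]) auto
  qed
  ultimately show ?thesis
    unfolding chain_space_def by (intro antisym span_minimal subspace_span span_mono) auto
qed


section \<open>The boundary of a monomial word\<close>

text \<open>The structure constants of the superalgebra in its monomial basis. They vanish for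
  \<open>j = k = 0\<close>, so the truncated exponent \<open>j + k - 1\<close> does no harm, and
  they vanish whenever the degrees add up to more than 2.\<close>

fun bracket_coeff :: "nat \<times> nat \<Rightarrow> nat \<times> nat \<Rightarrow> real" where
  "bracket_coeff (i, j) (i', k) =
    (if i = 0 \<and> i' = 0 then real k - real j
     else if i = 0 \<and> i' = 1 then real k
     else if i = 1 \<and> i' = 0 then - real j
     else if i = 0 \<and> i' = 2 \<or> i = 1 \<and> i' = 1 then real (j + k)
     else if i = 2 \<and> i' = 0 then - real (j + k)
     else 0)"

lemma bracket_mono_elem:
  assumes "i \<le> 2" "i' \<le> 2"
  shows "bracket (mono_elem (i, j)) (mono_elem (i', k)) =
    part (i + i') (smult (bracket_coeff (i, j) (i', k)) (monom 1 (j + k - 1)))"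
proof -
  have "i = 0 \<or> i = 1 \<or> i = 2" "i' = 0 \<or> i' = 1 \<or> i' = 2" using assms by auto
  then show ?thesis
    by (elim disjE; cases j; cases k)
      (simp_all add: mono_elem_def part_def pderiv_monom mult_monom smult_monom diff_monom
        minus_monom algebra_simps)
qed

definition boundary_coeff :: "(nat \<times> nat) list \<Rightarrow> nat \<Rightarrow> nat \<Rightarrow> real" where
  "boundary_coeff ts i j =
    (-1) ^ (i + fst (ts ! i) * (\<Sum>s\<leftarrow>[Suc i..<j]. fst (ts ! s))) * bracket_coeff (ts ! i) (ts ! j)"

definition contract_pair :: "(nat \<times> nat) list \<Rightarrow> nat \<Rightarrow> nat \<Rightarrow> (nat \<times> nat) list" where
  "contract_pair ts i j = take i ts @ drop (Suc i)
    (ts[j := (fst (ts ! i) + fst (ts ! j), snd (ts ! i) + snd (ts ! j) - 1)])"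

text \<open>Sums over lists replace the sum over a set of index pairs, so that for a concrete word
  the simplifier can expand the right-hand side completely.\<close>

lemma boundary_word_mono:
  assumes "\<forall>t\<in>set ts. fst t \<le> 2"
  shows "boundary (word ts) = (\<Sum>j\<leftarrow>[0..<length ts]. \<Sum>i\<leftarrow>[0..<j].
    boundary_coeff ts i j *\<^sub>R word (contract_pair ts i j))"
proof -
  have summand: "boundary_term (map mono_elem ts) i j =
      boundary_coeff ts i j *\<^sub>R word (contract_pair ts i j)"
    if ij: "i < j" "j < length ts" for i j
  proof -
    obtain a k b l where tt: "ts ! i = (a, k)" "ts ! j = (b, l)" by fastforce
    have d: "deg (mono_elem (ts ! s)) = fst (ts ! s)" if "s < length ts" for s
      using assms nth_mem[OF that] by (cases "ts ! s") (auto simp: deg_mono_elem)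
    have "(\<Sum>s\<in>{i<..<j}. deg (map mono_elem ts ! s)) = (\<Sum>s\<leftarrow>[Suc i..<j]. fst (ts ! s))"
      using ij d by (subst sum_list_distinct_conv_sum_set)
        (auto intro!: sum.cong simp: atLeastSucLessThan_greaterThanLessThan)
    moreover have "a \<le> 2" "b \<le> 2" using assms ij tt by (metis fst_conv nth_mem order.strict_trans)+
    then have br: "bracket (mono_elem (ts ! i)) (mono_elem (ts ! j)) =
        part (a + b) (smult (bracket_coeff (ts ! i) (ts ! j)) (monom 1 (k + l - 1)))"
      unfolding tt by (rule bracket_mono_elem)
    \<comment> \<open>Both the word and \<open>contract_pair\<close> are split at slot
      \<open>j\<close>, which exposes the bracket as a single factor from which its coefficient can
      be pulled out.\<close>
    have "take i (map mono_elem ts) @ drop (Suc i) ((map mono_elem ts)[j := P]) =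
        (map mono_elem (take i ts @ take (j - Suc i) (drop (Suc i) ts))) @ P #
          map mono_elem (drop (Suc j) ts)" for P
      using ij by (simp add: upd_conv_take_nth_drop take_map drop_map drop_take)
    moreover have "contract_pair ts i j =
        (take i ts @ take (j - Suc i) (drop (Suc i) ts)) @ (a + b, k + l - 1) # drop (Suc j) ts"
      using ij by (simp add: contract_pair_def tt upd_conv_take_nth_drop drop_take)
    ultimately show ?thesis
      using ij d[of i] br tri_smult[of "map mono_elem (take i ts @ take (j - Suc i) (drop (Suc i) ts))"
          "a + b" "bracket_coeff (ts ! i) (ts ! j)" "monom 1 (k + l - 1)"
          "map mono_elem (drop (Suc j) ts)"]
      by (simp add: boundary_term_def boundary_coeff_def word_def mono_elem_def)
  qed
  have "boundary (word ts) =
      (\<Sum>(i, j) | i < j \<and> j < length ts. boundary_coeff ts i j *\<^sub>R word (contract_pair ts i j))"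
    unfolding word_def[of ts] boundary_tri boundary_word_def
    by (rule sum.cong) (auto simp: summand)
  also have "\<dots> = (\<Sum>(j, i)\<in>(SIGMA j:{..<length ts}. {..<j}).
      boundary_coeff ts i j *\<^sub>R word (contract_pair ts i j))"
    by (rule sum.reindex_bij_witness[where i = prod.swap and j = prod.swap]) auto
  also have "\<dots> = (\<Sum>j\<leftarrow>[0..<length ts]. \<Sum>i\<leftarrow>[0..<j].
      boundary_coeff ts i j *\<^sub>R word (contract_pair ts i j))"
    by (simp add: sum.Sigma[symmetric] sum_list_distinct_conv_sum_set atLeast0LessThan)
  finally show ?thesis .
qed


section \<open>Coordinate functionals\<close>

fun letter_coeff :: "nat \<times> nat \<Rightarrow> elem \<Rightarrow> real" where
  "letter_coeff (i, j) A =
    (if deg A = i then coeff (case A of Vect p \<Rightarrow> p | Fn p \<Rightarrow> p | Form p \<Rightarrow> p) j else 0)"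

text \<open>The transposed left multiplication by the letter \<open>t\<close>: every occurrence of \<open>t\<close> in the word is
  moved to the front, with the sign of the supercommutation rule, and deleted.\<close>

primrec contraction ::
  "nat \<times> nat \<Rightarrow> (elem list \<Rightarrow> real) \<Rightarrow> elem list \<Rightarrow> real" where
  "contraction t F [] = 0"
| "contraction t F (A # As) = letter_coeff t A * F As
    - (-1) ^ (deg A * fst t) * contraction t (\<lambda>u. F (A # u)) As"

definition respects_relations :: "(elem list \<Rightarrow> real) \<Rightarrow> bool" where
  "respects_relations F \<longleftrightarrow>
    (\<forall>i us a p b q vs. i \<le> 2 \<longrightarrow> F (us @ part i (smult a p + smult b q) # vs) =
      a * F (us @ part i p # vs) + b * F (us @ part i q # vs)) \<and>
    (\<forall>us A B vs. F (us @ A # B # vs) = - ((-1) ^ (deg A * deg B) * F (us @ B # A # vs)))"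

text \<open>The recursion of \<open>contraction\<close> replaces \<open>F\<close> by
  \<open>F\<close> behind a fixed head letter; this keeps the inductions over the prefix
  going.\<close>

lemma respects_relations_Cons:
  "respects_relations F \<Longrightarrow> respects_relations (\<lambda>u. F (A # u))"
  unfolding respects_relations_def by (metis append_Cons)

lemma contraction_linear:
  "contraction t (\<lambda>u. a * F u + b * G u) As = a * contraction t F As + b * contraction t G As"
  by (induction As arbitrary: F G) (simp_all add: algebra_simps)

lemma letter_coeff_linear:
  "letter_coeff t (part i (smult a p + smult b q)) =
    a * letter_coeff t (part i p) + b * letter_coeff t (part i q)"
  by (cases t) (auto simp: part_def)

text \<open>Both properties reduce, by induction on the prefix, to a change at the front of the
  word. When two front letters are exchanged, the summands that delete one of them trade places, and
  those that delete a later letter change by the rule for \<open>F\<close>.\<close>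

lemma respects_relations_contraction:
  assumes "respects_relations F"
  shows "respects_relations (contraction t F)"
proof -
  have "contraction t F (us @ part i (smult a p + smult b q) # vs) =
      a * contraction t F (us @ part i p # vs) + b * contraction t F (us @ part i q # vs)"
    if "i \<le> 2" "respects_relations F" for i us a p b q vs F
    using that
  proof (induction us arbitrary: F)
    case Nil
    have "F (part i (smult a p + smult b q) # u) = a * F (part i p # u) + b * F (part i q # u)" for u
      using Nil unfolding respects_relations_def by (metis append_Nil)
    then have "contraction t (\<lambda>u. F (part i (smult a p + smult b q) # u)) vs =
        a * contraction t (\<lambda>u. F (part i p # u)) vs + b * contraction t (\<lambda>u. F (part i q # u)) vs"
      by (simp only: contraction_linear)
    then show ?case
      unfolding append_Nil contraction.simps letter_coeff_linear
        deg_part[of i "smult a p + smult b q" 0] deg_part[of i p 0] deg_part[of i q 0]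
      by (simp only: algebra_simps)
  next
    case (Cons A us)
    have "F (us @ part i (smult a p + smult b q) # vs) =
        a * F (us @ part i p # vs) + b * F (us @ part i q # vs)"
      using Cons.prems unfolding respects_relations_def by metis
    with Cons show ?case by (simp add: respects_relations_Cons algebra_simps)
  qed
  moreover have "contraction t F (us @ A # B # vs) =
      - ((-1) ^ (deg A * deg B) * contraction t F (us @ B # A # vs))"
    if "respects_relations F" for us A B vs F
    using that
  proof (induction us arbitrary: F)
    case Nil
    let ?e = "(-1) ^ (deg A * deg B) :: real"
    \<comment> \<open>The summand \<open>0 * 0\<close> gives the equation the two-term shape of
      \<open>contraction_linear\<close>.\<close>
    have "F (A # B # u) = - ?e * F (B # A # u) + 0 * 0" for u
      using Nil unfolding respects_relations_def
      by (metis append_Nil mult_minus_left mult_zero_left add_0_right)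
    then have c: "contraction t (\<lambda>u. F (A # B # u)) vs =
        - ?e * contraction t (\<lambda>u. F (B # A # u)) vs"
      by (simp only: contraction_linear[of t "- ?e" "\<lambda>u. F (B # A # u)" 0 "\<lambda>u. 0"])
    \<comment> \<open>Where \<open>letter_coeff t A\<close> is nonzero, \<open>A\<close> has the
      degree of \<open>t\<close>, so carrying \<open>t\<close> past \<open>B\<close> costs the same
      sign as carrying \<open>A\<close> past \<open>B\<close>.\<close>
    have swap: "(-1) ^ (deg B * fst t) * letter_coeff t A = ?e * letter_coeff t A"
      "(-1) ^ (deg A * fst t) * letter_coeff t B = ?e * letter_coeff t B"
      by (cases t; auto simp: mult.commute)+
    have "l * f - p * (l' * f' - q * (- e * x)) = - (e * (l' * f' - q * (l * f - p * x)))"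
      if "q * l = e * l" "p * l' = e * l'" "e * e = 1" for l l' f f' p q e x :: real
      using that by algebra
    moreover have "?e * ?e = 1" by (simp flip: power_add)
    ultimately show ?case
      unfolding append_Nil contraction.simps c using swap by blast
  next
    case (Cons C us)
    have "F (us @ A # B # vs) = - ((-1) ^ (deg A * deg B) * F (us @ B # A # vs))"
      using Cons.prems unfolding respects_relations_def by metis
    with Cons show ?case by (simp add: respects_relations_Cons algebra_simps)
  qed
  ultimately show ?thesis using assms unfolding respects_relations_def by metis
qed

section \<open>Descent of functionals from the free vector space to chains\<close>

definition free_extension :: "(elem list \<Rightarrow> real) \<Rightarrow> (elem list \<Rightarrow>\<^sub>0 real) \<Rightarrow> real" where
  "free_extension F x = (\<Sum>As \<in> Poly_Mapping.keys x. Poly_Mapping.lookup x As * F As)"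

lemma free_extension_single [simp]: "free_extension F (Poly_Mapping.single As 1) = F As"
  by (simp add: free_extension_def)

lemma linear_free_extension: "linear (free_extension F)"
proof (rule linearI)
  have sup: "free_extension F x = (\<Sum>As \<in> S. Poly_Mapping.lookup x As * F As)"
    if "finite S" "Poly_Mapping.keys x \<subseteq> S" for S x
    unfolding free_extension_def
    by (rule sum.mono_neutral_left) (use that in \<open>auto simp: in_keys_iff\<close>)
  fix x y :: "elem list \<Rightarrow>\<^sub>0 real" and c :: real
  let ?S = "Poly_Mapping.keys x \<union> Poly_Mapping.keys y"
  show "free_extension F (x + y) = free_extension F x + free_extension F y"
    using Poly_Mapping.keys_add[of x y]
    by (simp add: sup[of ?S] lookup_add distrib_right sum.distrib)
  show "free_extension F (c *\<^sub>R x) = c *\<^sub>R free_extension F x"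
    by (subst (1 2) sup[of "Poly_Mapping.keys x"])
      (auto simp: in_keys_iff scaleR_poly_mapping.rep_eq sum_distrib_left mult_ac)
qed

lemma free_extension_relations:
  assumes "respects_relations F" "x \<in> span chain_relations"
  shows "free_extension F x = 0"
proof (rule linear_eq_0_on_span[OF linear_free_extension _ assms(2)])
  note F = assms(1)[unfolded respects_relations_def]
  fix r assume "r \<in> chain_relations"
  then show "free_extension F r = 0"
  proof cases
    case (multilinear i us a p b q vs)
    then show ?thesis using F
      by (simp add: linear_diff[OF linear_free_extension] linear_scale[OF linear_free_extension])
  next
    case (supercommute us A B vs)
    have "F (us @ A # B # vs) = - ((-1) ^ (deg A * deg B) * F (us @ B # A # vs))"
      using F by blast
    then show ?thesis
      by (simp add: supercommute linear_add[OF linear_free_extension]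
          linear_scale[OF linear_free_extension])
  qed
qed

text \<open>Not normalised: a function letter occurring k times contributes k! to the value on the
  ordered word itself, for instance 2 for \<open>[(1, 0), (1, 0)]\<close>. Being nonzero is
  enough.\<close>

primrec word_functional :: "(nat \<times> nat) list \<Rightarrow> elem list \<Rightarrow> real" where
  "word_functional [] = (\<lambda>As. if As = [] then 1 else 0)"
| "word_functional (t # ts) = contraction t (word_functional ts)"

lemma respects_relations_word_functional: "respects_relations (word_functional ts)"
  by (induction ts)
    (simp_all only: word_functional.simps respects_relations_contraction, simp add: respects_relations_def)

lift_definition coord :: "(nat \<times> nat) list \<Rightarrow> chain \<Rightarrow> real"
  is "\<lambda>ts. free_extension (word_functional ts)"
proof -
  fix ts and x y :: "elem list \<Rightarrow>\<^sub>0 real"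
  assume "x - y \<in> span chain_relations"
  then have "free_extension (word_functional ts) (x - y) = 0"
    by (rule free_extension_relations[OF respects_relations_word_functional])
  then show "free_extension (word_functional ts) x = free_extension (word_functional ts) y"
    by (simp add: linear_diff[OF linear_free_extension])
qed

lemma linear_coord: "linear (coord ts)"
  by (rule linearI; transfer)
    (simp_all add: linear_add[OF linear_free_extension] linear_scale[OF linear_free_extension])

lemma coord_word: "coord ts (word us) = word_functional ts (map mono_elem us)"
  by (simp add: word_def tri_def coord.abs_eq)


section \<open>Quotient dimensions\<close>

definition quotient_basis :: "'a::real_vector set \<Rightarrow> 'a set \<Rightarrow> nat \<Rightarrow> (nat \<Rightarrow> 'a) \<Rightarrow> bool" where
  "quotient_basis V W d e \<longleftrightarrow> (\<forall>k<d. e k \<in> V) \<and>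
    (\<forall>v\<in>V. \<exists>!c. c \<in> {..<d} \<rightarrow>\<^sub>E UNIV \<and> v - (\<Sum>k<d. c k *\<^sub>R e k) \<in> W)"


text \<open>Writing each \<open>e k\<close> modulo \<open>W\<close> in terms of the
  \<open>e' l\<close> gives coefficient vectors \<open>p k\<close>. They are independent, because a
  relation among them is a relation among the \<open>e k\<close> modulo \<open>W\<close>, and they
  lie in the span of \<open>d'\<close> unit vectors. Finitely supported functions serve as a
  coordinate space whose type does not mention \<open>d'\<close>.\<close>

lemma quotient_basis_le:
  assumes V: "subspace V" and W: "subspace W"
    and e: "quotient_basis V W d e" and e': "quotient_basis V W d' e'"
  shows "d \<le> d'"
proof -
  have "\<forall>k. \<exists>c. k < d \<longrightarrow> e k - (\<Sum>l<d'. c l *\<^sub>R e' l) \<in> W"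
    using e e' unfolding quotient_basis_def by meson
  then obtain c where c: "e k - (\<Sum>l<d'. c k l *\<^sub>R e' l) \<in> W" if "k < d" for k by metis
  let ?u = "\<lambda>l. Poly_Mapping.single l 1 :: nat \<Rightarrow>\<^sub>0 real"
  define p where "p k = (\<Sum>l<d'. c k l *\<^sub>R ?u l)" for k
  have zero: "a k = 0" if a: "(\<Sum>k<d. a k *\<^sub>R p k) = 0" and k: "k < d" for a k
  proof -
    have "(\<Sum>k<d. a k * c k l) = 0" if "l < d'" for l
    proof -
      have "Poly_Mapping.lookup (p k) l = c k l" for k
        unfolding p_def using \<open>l < d'\<close>
        by (simp add: lookup_sum scaleR_poly_mapping.rep_eq lookup_single when_def if_distrib cong: if_cong)
      then show ?thesis
        using arg_cong[OF a, of "\<lambda>x. Poly_Mapping.lookup x l"]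
        by (simp add: lookup_sum scaleR_poly_mapping.rep_eq)
    qed
    then have "(\<Sum>k<d. a k *\<^sub>R (\<Sum>l<d'. c k l *\<^sub>R e' l)) = 0"
      unfolding scaleR_sum_right
      by (subst sum.swap) (simp flip: scaleR_sum_left add: sum_distrib_left)
    moreover have "(\<Sum>k<d. a k *\<^sub>R (e k - (\<Sum>l<d'. c k l *\<^sub>R e' l))) \<in> W"
      using c by (intro subspace_sum[OF W] subspace_scale[OF W]) auto
    ultimately have aW: "(\<Sum>k<d. a k *\<^sub>R e k) \<in> W"
      by (simp add: scaleR_diff_right sum_subtractf)
    \<comment> \<open>Uniqueness of coefficients is used for the zero class, which both
      \<open>a\<close> and the zero family represent; restriction makes them extensional.\<close>
    let ?P = "\<lambda>c. c \<in> {..<d} \<rightarrow>\<^sub>E UNIV \<and> 0 - (\<Sum>k<d. c k *\<^sub>R e k) \<in> W"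
    have ex1: "\<exists>!c. ?P c"
      using e subspace_0[OF V] unfolding quotient_basis_def by blast
    have P: "?P (restrict a {..<d})" using subspace_neg[OF W aW] by simp
    have P0: "?P (\<lambda>_\<in>{..<d}. 0)" using subspace_0[OF W] by simp
    have "restrict a {..<d} = (\<lambda>_\<in>{..<d}. 0)"
      by (rule trans[OF the1_equality[OF ex1, OF P, symmetric] the1_equality[OF ex1, OF P0]])
    then show ?thesis using k by (auto dest: fun_cong[of _ _ k])
  qed
  \<comment> \<open>Independence is a property of sets, so repetitions must be excluded separately:
    \<open>p i = p j\<close> is a relation with coefficients 1 and -1.\<close>
  have inj: "inj_on p {..<d}"
  proof (rule inj_onI)
    fix i j assume ij: "i \<in> {..<d}" "j \<in> {..<d}" "p i = p j"
    show "i = j"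
    proof (rule ccontr)
      assume "i \<noteq> j"
      have "(\<Sum>k<d. of_bool (k = i) *\<^sub>R p k) = (\<Sum>k<d. if k = i then p k else 0)" for i
        by (rule sum.cong) auto
      then have "(\<Sum>k<d. (of_bool (k = i) - of_bool (k = j)) *\<^sub>R p k) = p i - p j"
        using ij(1,2) by (simp add: scaleR_diff_left sum_subtractf)
      from zero[OF this[unfolded ij(3) diff_self], of i] ij \<open>i \<noteq> j\<close> show False by simp
    qed
  qed
  have "independent (p ` {..<d})"
  proof (rule independent_if_scalars_zero)
    fix f x assume f: "(\<Sum>x\<in>p ` {..<d}. f x *\<^sub>R x) = 0" and "x \<in> p ` {..<d}"
    then obtain k where k: "k < d" "x = p k" by auto
    from f have "(\<Sum>k<d. f (p k) *\<^sub>R p k) = 0" by (simp add: sum.reindex[OF inj])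
    then show "f x = 0" unfolding k(2) using k(1) by (rule zero)
  qed simp
  moreover have "p ` {..<d} \<subseteq> span (?u ` {..<d'})"
    by (auto simp: p_def intro!: span_sum span_scale intro: span_base)
  ultimately have "card (p ` {..<d}) \<le> card (?u ` {..<d'})"
    by (intro conjunct2[OF independent_span_bound]) auto
  also have "\<dots> \<le> d'" using card_image_le[of "{..<d'}" ?u] by simp
  finally show ?thesis by (simp add: card_image[OF inj])
qed

lemma quotient_dim_eqI:
  assumes "subspace V" "subspace W" "quotient_basis V W d e"
  shows "quotient_dim V W = d"
  unfolding quotient_dim_def quotient_basis_def[symmetric]
  using assms by (intro the_equality) (auto intro: quotient_basis_le antisym)

lemma quotient_dim_0:
  assumes "subspace V" "subspace W" "V \<subseteq> W"
  shows "quotient_dim V W = 0"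
  using assms by (intro quotient_dim_eqI[where e = "\<lambda>_. 0"]) (auto simp: quotient_basis_def)

lemma quotient_dim_1:
  assumes V: "subspace V" and W: "subspace W" and e: "e \<in> V" "e \<notin> W"
    and gen: "\<And>v. v \<in> V \<Longrightarrow> \<exists>a. v - a *\<^sub>R e \<in> W"
  shows "quotient_dim V W = 1"
proof (rule quotient_dim_eqI[OF V W])
  have "\<exists>!c. c \<in> {..<1 :: nat} \<rightarrow>\<^sub>E UNIV \<and> v - (\<Sum>k<1. c k *\<^sub>R e) \<in> W" if v: "v \<in> V" for v
  proof -
    have one: "{..<1 :: nat} = {0}" by auto
    obtain a where a: "v - a *\<^sub>R e \<in> W" using gen[OF v] by blast
    show ?thesis
    proof (rule ex1I[of _ "\<lambda>k\<in>{..<1 :: nat}. a"])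
      show "restrict (\<lambda>k. a) {..<1 :: nat} \<in> {..<1} \<rightarrow>\<^sub>E UNIV \<and>
          v - (\<Sum>k<1. restrict (\<lambda>k. a) {..<1 :: nat} k *\<^sub>R e) \<in> W"
        using a by (simp add: one)
      fix c :: "nat \<Rightarrow> real" assume c: "c \<in> {..<1} \<rightarrow>\<^sub>E UNIV \<and> v - (\<Sum>k<1. c k *\<^sub>R e) \<in> W"
      then have "(v - a *\<^sub>R e) - (v - c 0 *\<^sub>R e) \<in> W" by (intro subspace_diff[OF W a]) simp
      then have "(c 0 - a) *\<^sub>R e \<in> W" by (simp add: algebra_simps)
      \<comment> \<open>Otherwise division by \<open>c 0 - a\<close> would put \<open>e\<close> into
        \<open>W\<close>.\<close>
      then have "c 0 = a"
        using subspace_scale[OF W, of "(c 0 - a) *\<^sub>R e" "inverse (c 0 - a)"] e(2)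
        by (cases "c 0 = a") auto
      with c show "c = (\<lambda>k\<in>{..<1}. a)"
        by (intro PiE_ext[of c "{..<1}" "\<lambda>_. UNIV"]) auto
    qed
  qed
  with e(1) show "quotient_basis V W 1 (\<lambda>_. e)" by (simp add: quotient_basis_def)
qed


section \<open>The complexes of double weight\<close>

lemma linear_boundary: "linear boundary"
  by (rule linearI; transfer)
    (simp_all add: linear_add[OF linear_boundary_free] linear_scale[OF linear_boundary_free])

lemma subspace_cycles: "subspace {c \<in> span S. boundary c = 0}"
  using subspace_inter[OF subspace_span linear_subspace_kernel[OF linear_boundary]]
  by (simp add: Int_def)

text \<open>Keeping \<open>h\<close> fixed while the length grows by one raises the total exponent
  by one. The lists \<open>L\<close> and \<open>L'\<close> are parameters so that each application
  can verify them by evaluating \<open>words\<close>.\<close>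

lemma betti_words:
  assumes "h = int s - int m" "words (letters s) m w s = L"
    "words (letters (s + 1)) (m + 1) w (s + 1) = L'"
  shows "betti m w h = quotient_dim {c \<in> span (word ` set L). boundary c = 0}
    (span ((\<lambda>u. boundary (word u)) ` set L'))"
proof -
  have "chain_space m w h = span (word ` set L)" "chain_space (m + 1) w h = span (word ` set L')"
    using assms chain_space_words[of h s m w] chain_space_words[of h "s + 1" "m + 1" w] by simp_all
  then show ?thesis
    by (simp only: betti_def linear_span_image[OF linear_boundary, symmetric] image_image)
qed

lemma betti_0I:
  assumes "h = int s - int m" "words (letters s) m w s = L"
    "words (letters (s + 1)) (m + 1) w (s + 1) = L'"
    and "\<And>c. c \<in> span (word ` set L) \<Longrightarrow> boundary c = 0 \<Longrightarrow>
      c \<in> span ((\<lambda>u. boundary (word u)) ` set L')"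
  shows "betti m w h = 0"
  unfolding betti_words[OF assms(1-3)]
  by (rule quotient_dim_0[OF subspace_cycles subspace_span]) (use assms(4) in auto)

lemma betti_1I:
  assumes "h = int s - int m" "words (letters s) m w s = L"
    "words (letters (s + 1)) (m + 1) w (s + 1) = L'"
    and "e \<in> span (word ` set L)" "boundary e = 0"
    and "e \<notin> span ((\<lambda>u. boundary (word u)) ` set L')"
    and "\<And>c. c \<in> span (word ` set L) \<Longrightarrow> boundary c = 0 \<Longrightarrow>
      \<exists>a. c - a *\<^sub>R e \<in> span ((\<lambda>u. boundary (word u)) ` set L')"
  shows "betti m w h = 1"
  unfolding betti_words[OF assms(1-3)]
  by (rule quotient_dim_1[OF subspace_cycles subspace_span, of e]) (use assms(4-7) in auto)

lemma span_1: "v \<in> span {x} \<longleftrightarrow> (\<exists>a. v = a *\<^sub>R x)"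
  by (auto simp: span_breakdown_eq)

lemma span_2: "v \<in> span {x, y} \<longleftrightarrow> (\<exists>a b. v = a *\<^sub>R x + b *\<^sub>R y)"
  by (auto simp: span_breakdown_eq diff_eq_eq) (metis add.commute)+

lemma span_3: "v \<in> span {x, y, z} \<longleftrightarrow> (\<exists>a b c. v = a *\<^sub>R x + b *\<^sub>R y + c *\<^sub>R z)"
  unfolding span_breakdown_eq[of v x] span_2 by (simp add: diff_eq_eq add_ac)

text \<open>These words generate all chain spaces of the three complexes. Summands with a repeated
  vector field vanish by \<open>word_repeat_Vect\<close>; the remaining ones are collected.\<close>

lemma boundary_words:
  "boundary (word [(0, 1)]) = 0"
  "boundary (word [(0, 0), (0, 2)]) = 2 *\<^sub>R word [(0, 1)]"
  "boundary (word [(0, 0), (0, 1), (0, 2)]) = 0"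
  "boundary (word [(1, 0)]) = 0"
  "boundary (word [(0, 0), (1, 1)]) = word [(1, 0)]"
  "boundary (word [(0, 1), (1, 0)]) = 0"
  "boundary (word [(0, 0), (0, 1), (1, 1)]) = word [(0, 1), (1, 0)]"
  "boundary (word [(0, 0), (0, 2), (1, 0)]) = 2 *\<^sub>R word [(0, 1), (1, 0)]"
  "boundary (word [(0, 0), (0, 1), (0, 2), (1, 0)]) = 0"
  "boundary (word [(0, 0), (2, 0)]) = 0"
  "boundary (word [(1, 0), (1, 0)]) = 0"
  "boundary (word [(0, 0), (0, 1), (2, 0)]) = 0"
  "boundary (word [(0, 0), (1, 0), (1, 1)]) = word [(1, 0), (1, 0)] - word [(0, 0), (2, 0)]"
  "boundary (word [(0, 1), (1, 0), (1, 0)]) = 0"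
  "boundary (word [(0, 0), (0, 1), (1, 0), (1, 1)]) =
    word [(0, 1), (1, 0), (1, 0)] + word [(0, 0), (0, 1), (2, 0)]"
  "boundary (word [(0, 0), (0, 2), (1, 0), (1, 0)]) = 2 *\<^sub>R word [(0, 1), (1, 0), (1, 0)]"
  "boundary (word [(0, 0), (0, 1), (0, 2), (1, 0), (1, 0)]) = 0"
  by (simp_all add: boundary_word_mono boundary_coeff_def contract_pair_def word_repeat_Vect
      numeral_2_eq_2)

lemmas boundary_combination =
  linear_add[OF linear_boundary] linear_diff[OF linear_boundary] linear_scale[OF linear_boundary]
  boundary_words

lemmas coord_combination =
  linear_add[OF linear_coord] linear_diff[OF linear_coord] linear_scale[OF linear_coord]
  coord_word mono_elem_def part_def

lemma coord_nonzero: "coord ts x \<noteq> 0 \<Longrightarrow> x \<noteq> 0"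
  using linear_0[OF linear_coord] by metis

text \<open>There is one generator in each of the lengths 1, 2, 3, and only the boundary from length
  2 to length 1 is nonzero. The surviving class is the product of d/dx, x d/dx and x^2 d/dx, which
  span a copy of sl(2).\<close>

lemma betti_weight_0: "betti 1 0 0 = 0" "betti 2 0 0 = 0" "betti 3 0 0 = 1"
proof -
  show "betti 1 0 0 = 0"
  proof (rule betti_0I[where s = 1 and L = "[[(0, 1)]]" and L' = "[[(0, 0), (0, 2)]]"])
    fix c assume "c \<in> span (word ` set [[(0, 1)]])"
    \<comment> \<open>The bracket of d/dx and x^2 d/dx is 2x d/dx, hence the factor 1/2.\<close>
    then obtain a where "c = (a / 2) *\<^sub>R 2 *\<^sub>R word [(0, 1)]" by (auto simp: span_1)
    then show "c \<in> span ((\<lambda>u. boundary (word u)) ` set [[(0, 0), (0, 2)]])"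
      unfolding list.set image_insert image_empty span_1 boundary_words by blast
  qed (simp, code_simp, code_simp)
  show "betti 2 0 0 = 0"
  proof (rule betti_0I[where s = 2 and L = "[[(0, 0), (0, 2)]]" and L' = "[[(0, 0), (0, 1), (0, 2)]]"])
    fix c assume "c \<in> span (word ` set [[(0, 0), (0, 2)]])" and c: "boundary c = 0"
    then obtain a where a: "c = a *\<^sub>R word [(0, 0), (0, 2)]" by (auto simp: span_1)
    have "word [(0, 1)] \<noteq> 0" by (rule coord_nonzero[of "[(0, 1)]"]) (simp add: coord_combination)
    with c show "c \<in> span ((\<lambda>u. boundary (word u)) ` set [[(0, 0), (0, 1), (0, 2)]])"
      by (simp add: a boundary_combination span_zero)
  qed (simp, code_simp, code_simp)
  show "betti 3 0 0 = 1"
  \<comment> \<open>\<open>L'\<close> is empty: four distinct vector fields have total exponent at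
    least 6, but only 4 is available.\<close>
  proof (rule betti_1I[where s = 3 and L = "[[(0, 0), (0, 1), (0, 2)]]" and L' = "[]"
        and e = "word [(0, 0), (0, 1), (0, 2)]"])
    have "word [(0, 0), (0, 1), (0, 2)] \<noteq> 0"
      by (rule coord_nonzero[of "[(0, 0), (0, 1), (0, 2)]"]) (simp add: coord_combination)
    then show "word [(0, 0), (0, 1), (0, 2)] \<notin> span ((\<lambda>u. boundary (word u)) ` set [])" by simp
  next
    fix c assume "c \<in> span (word ` set [[(0, 0), (0, 1), (0, 2)]])"
    then show "\<exists>a. c - a *\<^sub>R word [(0, 0), (0, 1), (0, 2)] \<in> span ((\<lambda>u. boundary (word u)) ` set [])"
      by (auto simp: span_1)
  qed (simp, code_simp, code_simp, simp add: span_base, rule boundary_words)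
qed

text \<open>The chain spaces have dimensions 1, 2, 2, 1 in lengths 1 to 4; the boundaries out of
  lengths 2, 3, 4 have ranks 1, 1, 0.\<close>

lemma betti_weight_1: "betti 1 1 (-1) = 0" "betti 2 1 (-1) = 0" "betti 3 1 (-1) = 1"
  "betti 4 1 (-1) = 1"
proof -
  show "betti 1 1 (-1) = 0"
  proof (rule betti_0I[where s = 0 and L = "[[(1, 0)]]" and L' = "[[(0, 0), (1, 1)], [(0, 1), (1, 0)]]"])
    fix c assume "c \<in> span (word ` set [[(1, 0)]])"
    then show "c \<in> span ((\<lambda>u. boundary (word u)) ` set [[(0, 0), (1, 1)], [(0, 1), (1, 0)]])"
      unfolding list.set image_insert image_empty boundary_words by (auto simp: span_1 span_2)
  qed (simp, code_simp, code_simp)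
  show "betti 2 1 (-1) = 0"
  proof (rule betti_0I[where s = 1 and L = "[[(0, 0), (1, 1)], [(0, 1), (1, 0)]]"
        and L' = "[[(0, 0), (0, 1), (1, 1)], [(0, 0), (0, 2), (1, 0)]]"])
    fix c assume "c \<in> span (word ` set [[(0, 0), (1, 1)], [(0, 1), (1, 0)]])" and c: "boundary c = 0"
    then obtain a b where ab: "c = a *\<^sub>R word [(0, 0), (1, 1)] + b *\<^sub>R word [(0, 1), (1, 0)]"
      by (auto simp: span_2)
    have "word [(1, 0)] \<noteq> 0" by (rule coord_nonzero[of "[(1, 0)]"]) (simp add: coord_combination)
    with c have "a = 0" by (simp only: ab boundary_combination) simp
    then show "c \<in> span ((\<lambda>u. boundary (word u)) `
        set [[(0, 0), (0, 1), (1, 1)], [(0, 0), (0, 2), (1, 0)]])"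
      unfolding list.set image_insert image_empty boundary_words
      by (simp add: ab span_scale span_base)
  qed (simp, code_simp, code_simp)
  show "betti 3 1 (-1) = 1"
  \<comment> \<open>The two generators have boundaries in the ratio 1 to 2, so this \<open>e\<close>
    spans the cycles. The only incoming boundary is zero, so \<open>e\<close> survives as soon as it
    is nonzero.\<close>
  proof (rule betti_1I[where s = 2 and L = "[[(0, 0), (0, 1), (1, 1)], [(0, 0), (0, 2), (1, 0)]]"
        and L' = "[[(0, 0), (0, 1), (0, 2), (1, 0)]]"
        and e = "word [(0, 0), (0, 2), (1, 0)] - 2 *\<^sub>R word [(0, 0), (0, 1), (1, 1)]"])
    let ?e = "word [(0, 0), (0, 2), (1, 0)] - 2 *\<^sub>R word [(0, 0), (0, 1), (1, 1)]"
    have "?e \<noteq> 0"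
      by (rule coord_nonzero[of "[(0, 0), (0, 2), (1, 0)]"]) (simp add: coord_combination)
    then show "?e \<notin> span ((\<lambda>u. boundary (word u)) ` set [[(0, 0), (0, 1), (0, 2), (1, 0)]])"
      unfolding list.set image_insert image_empty boundary_words by simp
    show "?e \<in> span (word ` set [[(0, 0), (0, 1), (1, 1)], [(0, 0), (0, 2), (1, 0)]])"
      by (intro span_diff span_scale span_base) auto
    show "boundary ?e = 0" by (simp only: boundary_combination) simp
    fix c assume "c \<in> span (word ` set [[(0, 0), (0, 1), (1, 1)], [(0, 0), (0, 2), (1, 0)]])"
      and c: "boundary c = 0"
    then obtain a b where ab:
      "c = a *\<^sub>R word [(0, 0), (0, 1), (1, 1)] + b *\<^sub>R word [(0, 0), (0, 2), (1, 0)]"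
      by (auto simp: span_2)
    have "word [(0, 1), (1, 0)] \<noteq> 0"
      by (rule coord_nonzero[of "[(0, 1), (1, 0)]"]) (simp add: coord_combination)
    moreover have "(a + b * 2) *\<^sub>R word [(0, 1), (1, 0)] = 0"
      using c by (simp only: ab boundary_combination) (simp add: scaleR_add_left)
    ultimately have "a = - 2 * b" by simp
    then have "c - b *\<^sub>R ?e = 0" by (simp add: ab scaleR_diff_right)
    then show "\<exists>a. c - a *\<^sub>R ?e \<in>
        span ((\<lambda>u. boundary (word u)) ` set [[(0, 0), (0, 1), (0, 2), (1, 0)]])"
      using span_zero by metis
  qed (simp, code_simp, code_simp)
  show "betti 4 1 (-1) = 1"
  proof (rule betti_1I[where s = 3 and L = "[[(0, 0), (0, 1), (0, 2), (1, 0)]]" and L' = "[]"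
        and e = "word [(0, 0), (0, 1), (0, 2), (1, 0)]"])
    have "word [(0, 0), (0, 1), (0, 2), (1, 0)] \<noteq> 0"
      by (rule coord_nonzero[of "[(0, 0), (0, 1), (0, 2), (1, 0)]"]) (simp add: coord_combination)
    then show "word [(0, 0), (0, 1), (0, 2), (1, 0)] \<notin> span ((\<lambda>u. boundary (word u)) ` set [])"
      by simp
  next
    fix c assume "c \<in> span (word ` set [[(0, 0), (0, 1), (0, 2), (1, 0)]])"
    then show "\<exists>a. c - a *\<^sub>R word [(0, 0), (0, 1), (0, 2), (1, 0)] \<in>
        span ((\<lambda>u. boundary (word u)) ` set [])"
      by (auto simp: span_1)
  qed (simp, code_simp, code_simp, simp add: span_base, rule boundary_words)
qed

text \<open>The chain spaces have dimensions 2, 3, 2, 1 in lengths 2 to 5; the boundaries out of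
  lengths 2, 3, 4, 5 have ranks 0, 1, 2, 0.\<close>

lemma betti_weight_2: "betti 2 2 (-2) = 1" "betti 3 2 (-2) = 0" "betti 4 2 (-2) = 0"
  "betti 5 2 (-2) = 1"
proof -
  show "betti 2 2 (-2) = 1"
  proof (rule betti_1I[where s = 0 and L = "[[(0, 0), (2, 0)], [(1, 0), (1, 0)]]"
        and L' = "[[(0, 0), (0, 1), (2, 0)], [(0, 0), (1, 0), (1, 1)], [(0, 1), (1, 0), (1, 0)]]"
        and e = "word [(0, 0), (2, 0)]"])
    let ?W = "span ((\<lambda>u. boundary (word u)) `
      set [[(0, 0), (0, 1), (2, 0)], [(0, 0), (1, 0), (1, 1)], [(0, 1), (1, 0), (1, 0)]])"
    have W: "v \<in> ?W \<longleftrightarrow> (\<exists>k. v = k *\<^sub>R (word [(1, 0), (1, 0)] - word [(0, 0), (2, 0)]))" for v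
      unfolding list.set image_insert image_empty boundary_words span_3 by simp
    show "word [(0, 0), (2, 0)] \<notin> ?W"
    proof
      assume "word [(0, 0), (2, 0)] \<in> ?W"
      then obtain k where
        k: "word [(0, 0), (2, 0)] = k *\<^sub>R (word [(1, 0), (1, 0)] - word [(0, 0), (2, 0)])"
        unfolding W by blast
      \<comment> \<open>The first coordinate forces \<open>k = 0\<close>, the second
        \<open>k = -1\<close>.\<close>
      show False
        using arg_cong[OF k, of "coord [(1, 0), (1, 0)]"] arg_cong[OF k, of "coord [(0, 0), (2, 0)]"]
          linear_0[OF linear_coord]
        by (simp add: coord_combination)
    qed
    \<comment> \<open>Every chain here is a cycle, and the two generators are homologous; hence the
      coefficient \<open>a + b\<close> below.\<close>
    fix c assume "c \<in> span (word ` set [[(0, 0), (2, 0)], [(1, 0), (1, 0)]])"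
    then obtain a b where "c = a *\<^sub>R word [(0, 0), (2, 0)] + b *\<^sub>R word [(1, 0), (1, 0)]"
      by (auto simp: span_2)
    then have "c - (a + b) *\<^sub>R word [(0, 0), (2, 0)] =
        b *\<^sub>R (word [(1, 0), (1, 0)] - word [(0, 0), (2, 0)])"
      by (simp add: algebra_simps)
    then show "\<exists>a. c - a *\<^sub>R word [(0, 0), (2, 0)] \<in> ?W" unfolding W by blast
  qed (simp, code_simp, code_simp, simp add: span_base, rule boundary_words)
  show "betti 3 2 (-2) = 0"
  proof (rule betti_0I[where s = 1
        and L = "[[(0, 0), (0, 1), (2, 0)], [(0, 0), (1, 0), (1, 1)], [(0, 1), (1, 0), (1, 0)]]"
        and L' = "[[(0, 0), (0, 1), (1, 0), (1, 1)], [(0, 0), (0, 2), (1, 0), (1, 0)]]"])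
    fix c assume "c \<in> span (word `
        set [[(0, 0), (0, 1), (2, 0)], [(0, 0), (1, 0), (1, 1)], [(0, 1), (1, 0), (1, 0)]])"
      and c: "boundary c = 0"
    then obtain a b d where abd: "c = a *\<^sub>R word [(0, 0), (0, 1), (2, 0)] +
        b *\<^sub>R word [(0, 0), (1, 0), (1, 1)] + d *\<^sub>R word [(0, 1), (1, 0), (1, 0)]"
      by (auto simp: span_3)
    have "word [(1, 0), (1, 0)] - word [(0, 0), (2, 0)] \<noteq> 0"
      by (rule coord_nonzero[of "[(1, 0), (1, 0)]"]) (simp add: coord_combination)
    moreover have "b *\<^sub>R (word [(1, 0), (1, 0)] - word [(0, 0), (2, 0)]) = 0"
      using c by (simp only: abd boundary_combination) simp
    ultimately have "b = 0" by simp
    \<comment> \<open>The first boundary, taken \<open>a\<close> times, already supplies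
      \<open>a\<close> copies of \<open>word [(0, 1), (1, 0), (1, 0)]\<close>; the second boundary
      is twice that word and supplies the other \<open>d - a\<close>.\<close>
    moreover have "(d - a) / 2 * 2 = d - a" by simp
    ultimately have "c = a *\<^sub>R (word [(0, 1), (1, 0), (1, 0)] + word [(0, 0), (0, 1), (2, 0)]) +
        ((d - a) / 2) *\<^sub>R 2 *\<^sub>R word [(0, 1), (1, 0), (1, 0)]"
      by (simp only: abd scaleR_scaleR) (simp add: algebra_simps)
    then show "c \<in> span ((\<lambda>u. boundary (word u)) `
        set [[(0, 0), (0, 1), (1, 0), (1, 1)], [(0, 0), (0, 2), (1, 0), (1, 0)]])"
      unfolding list.set image_insert image_empty boundary_words span_2 by blast
  qed (simp, code_simp, code_simp)
  show "betti 4 2 (-2) = 0"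
  proof (rule betti_0I[where s = 2
        and L = "[[(0, 0), (0, 1), (1, 0), (1, 1)], [(0, 0), (0, 2), (1, 0), (1, 0)]]"
        and L' = "[[(0, 0), (0, 1), (0, 2), (1, 0), (1, 0)]]"])
    fix c assume "c \<in> span (word `
        set [[(0, 0), (0, 1), (1, 0), (1, 1)], [(0, 0), (0, 2), (1, 0), (1, 0)]])"
      and c: "boundary c = 0"
    then obtain a b where ab: "c = a *\<^sub>R word [(0, 0), (0, 1), (1, 0), (1, 1)] +
        b *\<^sub>R word [(0, 0), (0, 2), (1, 0), (1, 0)]"
      by (auto simp: span_2)
    have z: "a *\<^sub>R (word [(0, 1), (1, 0), (1, 0)] + word [(0, 0), (0, 1), (2, 0)]) +
        b *\<^sub>R 2 *\<^sub>R word [(0, 1), (1, 0), (1, 0)] = 0"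
      using c by (simp only: ab boundary_combination)
    \<comment> \<open>The word with a 1-form occurs only in the first boundary, so its coordinate
      isolates \<open>a\<close>; the other coordinate then isolates \<open>b\<close>.\<close>
    have "a = 0"
      using arg_cong[OF z, of "coord [(0, 0), (0, 1), (2, 0)]"] linear_0[OF linear_coord]
      by (simp add: coord_combination)
    moreover have "b = 0"
      using arg_cong[OF z, of "coord [(0, 1), (1, 0), (1, 0)]"] linear_0[OF linear_coord] \<open>a = 0\<close>
      by (simp add: coord_combination)
    ultimately show "c \<in> span ((\<lambda>u. boundary (word u)) `
        set [[(0, 0), (0, 1), (0, 2), (1, 0), (1, 0)]])"
      by (simp add: ab span_zero)
  qed (simp, code_simp, code_simp)
  show "betti 5 2 (-2) = 1"
  \<comment> \<open>Length 6 would need at least four distinct vector fields, of total exponent at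
    least 6, while only 4 is available.\<close>
  proof (rule betti_1I[where s = 3 and L = "[[(0, 0), (0, 1), (0, 2), (1, 0), (1, 0)]]" and L' = "[]"
        and e = "word [(0, 0), (0, 1), (0, 2), (1, 0), (1, 0)]"])
    have "word [(0, 0), (0, 1), (0, 2), (1, 0), (1, 0)] \<noteq> 0"
      by (rule coord_nonzero[of "[(0, 0), (0, 1), (0, 2), (1, 0), (1, 0)]"])
        (simp add: coord_combination)
    then show "word [(0, 0), (0, 1), (0, 2), (1, 0), (1, 0)] \<notin>
        span ((\<lambda>u. boundary (word u)) ` set [])"
      by simp
  next
    fix c assume "c \<in> span (word ` set [[(0, 0), (0, 1), (0, 2), (1, 0), (1, 0)]])"
    then show "\<exists>a. c - a *\<^sub>R word [(0, 0), (0, 1), (0, 2), (1, 0), (1, 0)] \<in>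
        span ((\<lambda>u. boundary (word u)) ` set [])"
      by (auto simp: span_1)
  qed (simp, code_simp, code_simp, simp add: span_base, rule boundary_words)
qed

theorem mainTheorem2:
  shows "(betti 1 0 0, betti 2 0 0, betti 3 0 0) = (0, 0, 1) \<and>
    (betti 1 1 (-1), betti 2 1 (-1), betti 3 1 (-1), betti 4 1 (-1)) = (0, 0, 1, 1) \<and>
    (betti 2 2 (-2), betti 3 2 (-2), betti 4 2 (-2), betti 5 2 (-2)) = (1, 0, 0, 1)"
  using betti_weight_0 betti_weight_1 betti_weight_2 by simp

end
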